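(* Assume that there exist $0<q<1$ and $C>0$ such that $b_k\le Cq^k$ for all $k\ge 1$, and that $\int_0^\infty \mu(t)\,dt=+\infty$. Then the Markov chain $X(t)$ is weakly ergodic, and for any $\delta\in(q,1)$, any initial condition $\mathbf w(0)\in l_1$ and any $t\ge 0$, the solution $\mathbf w(t)$ of $\frac{d}{dt}\mathbf w(t)=B^{**}(t)\mathbf w(t)$ (with $B^{**}$ built from this $\delta$ as in the context) satisfies $$\|\mathbf w(t)\|\le e^{-\int_0^t(1-\delta)\mu(u)\,du}\,\|\mathbf w(0)\|.$$ If moreover, for a $\delta\in(q,1)$, there exist $N>0$ and $a>0$ such that $$e^{-\int_s^t(1-\delta)\mu(u)\,du}\le N e^{-a(t-s)}\quad\text{for all }0\le s\le t,$$ then $X(t)$ is exponentially weakly ergodic (in the norm corresponding to this $\delta$).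
   Context: Queue model. Let $\lambda,\mu:[0,\infty)\to[0,\infty)$ be non-random locally integrable functions with $\lambda(t)\le L<\infty$ for all $t\ge0$. Let $\{b_n,\ n\ge1\}$ be a probability distribution on $\{1,2,\dots\}$ (batch sizes) with finite mean, and put $B_k=\sum_{n\ge k}b_n$ (so $B_1=1$). Customers arrive in batches according to a Poisson process of intensity $\lambda(t)$; batch sizes are distributed as $\{b_n\}$. A batch whose size is strictly larger than the current number of customers replaces all the customers in the system; otherwise it is lost. Customers are served one by one with intensity $\mu(t)$. $X(t)$ is the number of customers at time $t$: it is a continuous-time Markov chain on $\mathcal X=\{0,1,\dots,b^*\}$, where $b^*=\max\{n: b_n>0\}$ (with $\mathcal X=\{0,1,2,\dots\}$ if the batch size has infinite support). Its transition intensities $q_{ij}(t)$ are: $q_{ij}(t)=\lambda(t)b_j$ for $j>i$; $q_{i,i-1}(t)=\mu(t)$ for $i\ge1$; $q_{00}(t)=-\lambda(t)$; $q_{ii}(t)=-(\mu(t)+\lambda(t)B_{i+1})$ for $i\ge1$; all others $0$. If $b^*<\infty$, all vectors and matrices below are truncated to the index set of $\mathcal X$ (or $\mathcal X\setminus\{0\}$). Let $Q(t)=(q_{ij}(t))$ and $A(t)=Q(t)^T$. The probability vector $\mathbf p(t)=(p_0(t),p_1(t),\dots)^T$, $p_i(t)=\mathbf P(X(t)=i)$, satisfies the forward Kolmogorov system $\frac{d}{dt}\mathbf p(t)=A(t)\mathbf p(t)$. All differential equations are understood for $l_1$-valued solutions (for almost every $t$, since the coefficients are only locally integrable). $\|\cdot\|$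 is the $l_1$-norm. Transformed system. For two solutions $\mathbf p^*,\mathbf p^{**}$ with initial conditions that are probability vectors, let $\mathbf z^*,\mathbf z^{**}$ be obtained by deleting the coordinate with index $0$, and $\mathbf y(t)=\mathbf z^*(t)-\mathbf z^{**}(t)=(y_1(t),y_2(t),\dots)^T$. Let $T$ be the upper triangular matrix with all entries on and above the diagonal equal to $1$, so $(T\mathbf y)_i=\sum_{j\ge i}y_j$. For $\delta\in(0,1)$ let $D=\mathrm{diag}(d_1,d_2,\dots)$ with $d_1=1$, $d_{k+1}=\delta^{-k}$, $k\ge1$. Let $B^*(t)$ be the matrix indexed by $i,j\ge1$ with diagonal entries $-(\mu(t)+\lambda(t)B_i)$, entries $\mu(t)$ at positions $(i,i+1)$, and all other entries $0$; put $B^{**}(t)=DB^*(t)D^{-1}$. Then $\mathbf w(t)=DT\mathbf y(t)$ satisfies $\frac{d}{dt}\mathbf w(t)=B^{**}(t)\mathbf w(t)$ whenever $\mathbf w(0)\in l_1$. Ergodicity. $X(t)$ is weakly ergodic if $\|\mathbf p^*(t)-\mathbf p^{**}(t)\|\to0$ as $t\to\infty$ for any initial probability vectors $\mathbf p^*(0),\mathbf p^{**}(0)$. $X(t)$ is exponentially weakly ergodic (in the norm $\|DT\,\cdot\|$ corresponding to $\delta$) if there are $M,a>0$ such that $\|DT(\mathbf z^*(t)-\mathbf z^{**}(t))\|\le Me^{-a(t-s)}\|DT(\mathbf z^*(s)-\mathbf z^{**}(s))\|$ for all $0\le s\le t$ and any two solutions for which the right-hand side is finite. *)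

theory Defs
  imports "HOL-Probability.Probability"
begin

text \<open>
  Vectors and matrices over an index set \<open>I \<subseteq> \<nat>\<close> are functions on \<open>nat\<close>. Only their values at
  indices in \<open>I\<close> matter, so that truncation to a finite state space is a choice of \<open>I\<close>.
\<close>

definition in_l1 :: "nat set \<Rightarrow> (nat \<Rightarrow> real) \<Rightarrow> bool" where
  "in_l1 I x \<longleftrightarrow> (\<lambda>i. \<bar>x i\<bar>) summable_on I"

definition l1_norm :: "nat set \<Rightarrow> (nat \<Rightarrow> real) \<Rightarrow> real" where
  "l1_norm I x = (\<Sum>\<^sub>\<infinity>i\<in>I. \<bar>x i\<bar>)"

definition mat_vec :: "nat set \<Rightarrow> (nat \<Rightarrow> nat \<Rightarrow> real) \<Rightarrow> (nat \<Rightarrow> real) \<Rightarrow> nat \<Rightarrow> real" where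
  "mat_vec I M x = (\<lambda>i. \<Sum>\<^sub>\<infinity>j\<in>I. M i j * x j)"

definition has_l1_derivative ::
    "nat set \<Rightarrow> (real \<Rightarrow> nat \<Rightarrow> real) \<Rightarrow> (nat \<Rightarrow> real) \<Rightarrow> real \<Rightarrow> bool" where
  "has_l1_derivative I w v t \<longleftrightarrow> in_l1 I v \<and>
     ((\<lambda>s. l1_norm I (\<lambda>i. (w s i - w t i) / (s - t) - v i)) \<longlongrightarrow> 0) (at t within {0..})"

text \<open>
  Absolute continuity in the \<open>l\<^sub>1\<close>-norm on every \<open>[0, \<tau>]\<close>; \<open>D\<close> ranges over the finite families of
  non-overlapping compact intervals contained in \<open>[0, \<tau>]\<close>.
\<close>

definition locally_l1_abs_cont :: "nat set \<Rightarrow> (real \<Rightarrow> nat \<Rightarrow> real) \<Rightarrow> bool" where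
  "locally_l1_abs_cont I w \<longleftrightarrow>
     (\<forall>\<tau>>0. \<forall>\<epsilon>>0. \<exists>\<eta>>0. \<forall>D :: real set set.
        D division_of \<Union>D \<longrightarrow> \<Union>D \<subseteq> {0..\<tau>} \<longrightarrow> (\<Sum>K\<in>D. Sup K - Inf K) < \<eta> \<longrightarrow>
        (\<Sum>K\<in>D. l1_norm I (\<lambda>i. w (Sup K) i - w (Inf K) i)) < \<epsilon>)"

text \<open>
  \<open>l\<^sub>1\<close>-valued solutions on \<open>[0, \<infinity>)\<close> of \<open>w' = M(t) w\<close> in the sense of Caratheodory. Absolute
  continuity cannot be dropped: an equation that holds only almost everywhere does not
  determine \<open>w\<close> from \<open>w 0\<close>.
\<close>

definition l1_solution ::
    "nat set \<Rightarrow> (real \<Rightarrow> nat \<Rightarrow> nat \<Rightarrow> real) \<Rightarrow> (real \<Rightarrow> nat \<Rightarrow> real) \<Rightarrow> bool" where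
  "l1_solution I M w \<longleftrightarrow>
     (\<forall>t\<ge>0. in_l1 I (w t)) \<and> locally_l1_abs_cont I w \<and>
     (AE t in lebesgue. 0 \<le> t \<longrightarrow> has_l1_derivative I w (mat_vec I (M t) (w t)) t)"

definition prob_vector :: "nat set \<Rightarrow> (nat \<Rightarrow> real) \<Rightarrow> bool" where
  "prob_vector I x \<longleftrightarrow> (\<forall>i\<in>I. 0 \<le> x i) \<and> (x has_sum 1) I"


definition states :: "nat pmf \<Rightarrow> nat set" where
  "states b = (if finite (set_pmf b) then {0..Max (set_pmf b)} else UNIV)"

definition pos_states :: "nat pmf \<Rightarrow> nat set" where
  "pos_states b = states b - {0}"

definition batch_tail :: "nat pmf \<Rightarrow> nat \<Rightarrow> real" where
  "batch_tail b k = (\<Sum>\<^sub>\<infinity>n\<in>{k..}. pmf b n)"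

definition intensity ::
    "(real \<Rightarrow> real) \<Rightarrow> (real \<Rightarrow> real) \<Rightarrow> nat pmf \<Rightarrow> real \<Rightarrow> nat \<Rightarrow> nat \<Rightarrow> real" where
  "intensity lam mu b t i j =
     (if i < j then lam t * pmf b j
      else if i = Suc j then mu t
      else if i = j then (if i = 0 then - lam t else - (mu t + lam t * batch_tail b (i + 1)))
      else 0)"

definition forward_matrix ::
    "(real \<Rightarrow> real) \<Rightarrow> (real \<Rightarrow> real) \<Rightarrow> nat pmf \<Rightarrow> real \<Rightarrow> nat \<Rightarrow> nat \<Rightarrow> real" where
  "forward_matrix lam mu b t i j = intensity lam mu b t j i"

text \<open>
  The chain enters through its state distributions: \<open>l\<^sub>1\<close>-valued solutions of the forward
  Kolmogorov system that start from a probability vector.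
\<close>

definition forward_solution ::
    "(real \<Rightarrow> real) \<Rightarrow> (real \<Rightarrow> real) \<Rightarrow> nat pmf \<Rightarrow> (real \<Rightarrow> nat \<Rightarrow> real) \<Rightarrow> bool" where
  "forward_solution lam mu b p \<longleftrightarrow>
     l1_solution (states b) (forward_matrix lam mu b) p \<and> prob_vector (states b) (p 0)"

definition weakly_ergodic :: "(real \<Rightarrow> real) \<Rightarrow> (real \<Rightarrow> real) \<Rightarrow> nat pmf \<Rightarrow> bool" where
  "weakly_ergodic lam mu b \<longleftrightarrow>
     (\<forall>p p'. forward_solution lam mu b p \<longrightarrow> forward_solution lam mu b p' \<longrightarrow>
        ((\<lambda>t. l1_norm (states b) (\<lambda>i. p t i - p' t i)) \<longlongrightarrow> 0) at_top)"


text \<open>Below, indices start at 1, so \<open>d\<^sub>1 = 1\<close> and \<open>d\<^bsub>k+1\<^esub> = \<delta>\<^bsup>-k\<^esup>\<close>.\<close>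

definition weight :: "real \<Rightarrow> nat \<Rightarrow> real" where
  "weight \<delta> k = inverse \<delta> ^ (k - 1)"

definition T_mat :: "nat \<Rightarrow> nat \<Rightarrow> real" where
  "T_mat i j = (if i \<le> j then 1 else 0)"

definition DT :: "nat set \<Rightarrow> real \<Rightarrow> (nat \<Rightarrow> real) \<Rightarrow> nat \<Rightarrow> real" where
  "DT I \<delta> y = (\<lambda>i. weight \<delta> i * mat_vec I T_mat y i)"

definition B_star ::
    "(real \<Rightarrow> real) \<Rightarrow> (real \<Rightarrow> real) \<Rightarrow> nat pmf \<Rightarrow> real \<Rightarrow> nat \<Rightarrow> nat \<Rightarrow> real" where
  "B_star lam mu b t i j =
     (if i = j then - (mu t + lam t * batch_tail b i) else if j = i + 1 then mu t else 0)"

definition B_star_star ::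
    "(real \<Rightarrow> real) \<Rightarrow> (real \<Rightarrow> real) \<Rightarrow> nat pmf \<Rightarrow> real \<Rightarrow> real \<Rightarrow> nat \<Rightarrow> nat \<Rightarrow> real" where
  "B_star_star lam mu b \<delta> t i j = weight \<delta> i * B_star lam mu b t i j * inverse (weight \<delta> j)"

text \<open>
  The requirement that \<open>DT (z - z')\<close> is in \<open>l\<^sub>1\<close> at time \<open>s\<close> says that the right-hand side is
  finite. Its counterpart at time \<open>t\<close> is part of the claim, because the infinite sum of a
  non-summable family is 0 by convention. Deleting the coordinate 0 is the restriction
  to \<open>pos_states b\<close>.
\<close>

definition exp_weakly_ergodic ::
    "(real \<Rightarrow> real) \<Rightarrow> (real \<Rightarrow> real) \<Rightarrow> nat pmf \<Rightarrow> real \<Rightarrow> bool" where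
  "exp_weakly_ergodic lam mu b \<delta> \<longleftrightarrow>
     (\<exists>M>0. \<exists>a>0. \<forall>p p' s t.
        forward_solution lam mu b p \<longrightarrow> forward_solution lam mu b p' \<longrightarrow> 0 \<le> s \<longrightarrow> s \<le> t \<longrightarrow>
        (let w = (\<lambda>r. DT (pos_states b) \<delta> (\<lambda>i. p r i - p' r i)) in
         in_l1 (pos_states b) (w s) \<longrightarrow>
         in_l1 (pos_states b) (w t) \<and>
         l1_norm (pos_states b) (w t) \<le> M * exp (- a * (t - s)) * l1_norm (pos_states b) (w s)))"

end

theory Submission
  imports Defs
begin

text \<open>
  Euler steps \<open>x \<mapsto> x + h M(r) x\<close> with small \<open>h\<close> inherit the column structure of \<open>M\<close>: for the forward
  matrix they do not increase the \<open>l\<^sub>1\<close>-norm, and they multiply the norm \<open>\<parallel>DT x\<parallel>\<close> of a vector with sum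
  zero by at most \<open>1 - h (1 - \<delta>) \<mu>(r)\<close>, because \<open>DT\<close> conjugates them to Euler steps of \<open>B\<^sup>*\<^sup>*\<close>. A
  Caratheodory solution is a limit of products of such steps along fine tagged partitions: tags in
  the null set where the derivative fails are skipped, at a small cost by absolute continuity, and
  the sums of \<open>h (1 - \<delta>) \<mu>(r)\<close> are Henstock-Kurzweil sums of \<open>\<integral> (1 - \<delta>) \<mu>\<close>. So every bound for the
  steps becomes a bound for solutions, without any existence theory for the differential equation.
  For weak ergodicity, the difference of two initial vectors is approximated in \<open>l\<^sub>1\<close> by a finitely
  supported vector with sum zero; the Euler products carry the error along without increasing it.
\<close>

section \<open>Matrices acting on \<open>l\<^sub>1\<close>\<close>

text \<open>The obstacle is that mu is only locally integrable: A(r) is bounded on l1 for each r,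
  but with no bound uniform in r, and the differential equation holds only almost everywhere. Step
  lengths must therefore depend on the tag. Gauges allow this: fineness at r can encode at once the
  differentiability at r, a limit on h that keeps the diagonal of I + h M(r) nonnegative, and the
  closeness of Riemann sums. The conjugation by DT reflects a feature of the queue. A batch replaces
  all customers, so the rate of jumping from below level i to level i or higher is lambda B_i from
  every state j < i. In a zero-sum vector the mass below i is minus the tail at i, hence the tails
  obey a closed bidiagonal system. The weights multiply its superdiagonal mu by \<delta>, so a
  column of the step matrix has norm at most 1 - h (mu + lambda B_j) + h \<delta> mu, and the rate
  (1 - \<delta>) mu appears.\<close>

lemma in_l1_summable: "in_l1 I x \<Longrightarrow> x summable_on I"
  using summable_on_iff_abs_summable_on_real[of x I] by (simp add: in_l1_def)

lemma in_l1_subset: "in_l1 I x \<Longrightarrow> J \<subseteq> I \<Longrightarrow> in_l1 J x"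
  unfolding in_l1_def by (rule summable_on_subset)

lemma in_l1_cong: "(\<And>i. i \<in> I \<Longrightarrow> x i = y i) \<Longrightarrow> in_l1 I x \<longleftrightarrow> in_l1 I y"
  unfolding in_l1_def by (rule summable_on_cong) auto

lemma l1_norm_cong: "(\<And>i. i \<in> I \<Longrightarrow> x i = y i) \<Longrightarrow> l1_norm I x = l1_norm I y"
  unfolding l1_norm_def by (rule infsum_cong) auto

lemma in_l1_add: "in_l1 I x \<Longrightarrow> in_l1 I y \<Longrightarrow> in_l1 I (\<lambda>i. x i + y i)"
  unfolding in_l1_def
  by (rule summable_on_comparison_test[where f = "\<lambda>i. \<bar>x i\<bar> + \<bar>y i\<bar>"]) (auto intro: summable_on_add)

lemma in_l1_cmult: "in_l1 I x \<Longrightarrow> in_l1 I (\<lambda>i. c * x i)"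
  unfolding in_l1_def abs_mult by (rule summable_on_cmult_right)

lemma in_l1_diff: "in_l1 I x \<Longrightarrow> in_l1 I y \<Longrightarrow> in_l1 I (\<lambda>i. x i - y i)"
  using in_l1_add[OF _ in_l1_cmult[of I y "-1"], of x] by simp

lemma in_l1_finite_support: "finite F \<Longrightarrow> (\<And>i. i \<in> I - F \<Longrightarrow> x i = 0) \<Longrightarrow> in_l1 I x"
  unfolding in_l1_def by (rule finite_nonzero_values_imp_summable_on) (rule finite_subset[of _ F], auto)

lemma l1_norm_nonneg [simp]: "0 \<le> l1_norm I x"
  unfolding l1_norm_def by (rule infsum_nonneg) simp

lemma l1_norm_add:
  assumes "in_l1 I x" "in_l1 I y"
  shows "l1_norm I (\<lambda>i. x i + y i) \<le> l1_norm I x + l1_norm I y"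
proof -
  have "l1_norm I (\<lambda>i. x i + y i) \<le> (\<Sum>\<^sub>\<infinity>i\<in>I. \<bar>x i\<bar> + \<bar>y i\<bar>)"
    unfolding l1_norm_def using assms in_l1_add[OF assms]
    by (intro infsum_mono summable_on_add) (auto simp: in_l1_def)
  also have "\<dots> = l1_norm I x + l1_norm I y"
    unfolding l1_norm_def using assms by (intro infsum_add) (auto simp: in_l1_def)
  finally show ?thesis .
qed

lemma l1_norm_cmult: "l1_norm I (\<lambda>i. c * x i) = \<bar>c\<bar> * l1_norm I x"
  unfolding l1_norm_def abs_mult by (rule infsum_cmult_right')

lemma l1_norm_diff_commute: "l1_norm I (\<lambda>i. x i - y i) = l1_norm I (\<lambda>i. y i - x i)"
  unfolding l1_norm_def by (simp add: abs_minus_commute)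

lemma l1_norm_diff:
  assumes "in_l1 I x" "in_l1 I y"
  shows "l1_norm I (\<lambda>i. x i - y i) \<le> l1_norm I x + l1_norm I y"
  using l1_norm_add[OF assms(1) in_l1_cmult[OF assms(2), of "-1"]] l1_norm_cmult[of I "-1" y] by simp

lemma l1_norm_triangle:
  assumes "in_l1 I (\<lambda>i. x i - y i)" "in_l1 I (\<lambda>i. y i - z i)"
  shows "l1_norm I (\<lambda>i. x i - z i) \<le> l1_norm I (\<lambda>i. x i - y i) + l1_norm I (\<lambda>i. y i - z i)"
  using l1_norm_add[OF assms] by simp

lemma abs_infsum_le_l1_norm: "in_l1 I x \<Longrightarrow> \<bar>infsum x I\<bar> \<le> l1_norm I x"
  using norm_infsum_bound[of x I] by (simp add: in_l1_def l1_norm_def)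

lemma l1_norm_subset: "in_l1 I x \<Longrightarrow> J \<subseteq> I \<Longrightarrow> l1_norm J x \<le> l1_norm I x"
  unfolding l1_norm_def using in_l1_subset[of I x J]
  by (intro infsum_mono_neutral) (auto simp: in_l1_def)

lemma finite_sum_le_l1_norm: "in_l1 I x \<Longrightarrow> finite F \<Longrightarrow> F \<subseteq> I \<Longrightarrow> (\<Sum>i\<in>F. \<bar>x i\<bar>) \<le> l1_norm I x"
  unfolding l1_norm_def in_l1_def by (intro finite_sum_le_infsum) auto

text \<open>Finite partial sums deliver membership and bound together. The bound alone would say
  nothing, since \<open>l1_norm\<close> is 0 by convention on a non-summable family.\<close>

lemma l1_bounded_finite_sums:
  assumes "\<And>F. finite F \<Longrightarrow> F \<subseteq> I \<Longrightarrow> (\<Sum>i\<in>F. \<bar>x i\<bar>) \<le> K"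
  shows "in_l1 I x \<and> l1_norm I x \<le> K"
proof -
  have "in_l1 I x"
    unfolding in_l1_def
    by (rule nonneg_bdd_above_summable_on) (use assms in \<open>auto intro!: bdd_aboveI[where M = K]\<close>)
  moreover from this have "l1_norm I x \<le> K"
    unfolding l1_norm_def in_l1_def using assms by (intro infsum_le_finite_sums) auto
  ultimately show ?thesis ..
qed

text \<open>The operator norm on l1 is the supremum of the column norms, so this expresses that
  \<open>P\<close> acts on l1 with norm at most \<open>C\<close>.\<close>

definition col_bounded :: "nat set \<Rightarrow> (nat \<Rightarrow> nat \<Rightarrow> real) \<Rightarrow> real \<Rightarrow> bool" where
  "col_bounded I P C \<longleftrightarrow> (\<forall>j\<in>I. in_l1 I (\<lambda>i. P i j) \<and> l1_norm I (\<lambda>i. P i j) \<le> C)"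

lemma col_boundedD:
  assumes "col_bounded I P C" "j \<in> I"
  shows "in_l1 I (\<lambda>i. P i j)" "l1_norm I (\<lambda>i. P i j) \<le> C"
  using assms by (auto simp: col_bounded_def)

text \<open>Tonelli for the double family, with the column index outside because the column norms
  are what is controlled. The interchanges of summation in the next lemmas rest on it.\<close>

lemma col_bounded_product_summable:
  assumes P: "col_bounded I P C" and x: "in_l1 I x"
  shows "(\<lambda>p. norm (case p of (j, i) \<Rightarrow> P i j * x j)) summable_on I \<times> I"
proof -
  have *: "(\<Sum>\<^sub>\<infinity>i\<in>I. \<bar>P i j * x j\<bar>) = l1_norm I (\<lambda>i. P i j) * \<bar>x j\<bar>" for j
    unfolding l1_norm_def abs_mult by (rule infsum_cmult_left')
  have "(\<lambda>j. l1_norm I (\<lambda>i. P i j) * \<bar>x j\<bar>) summable_on I"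
    by (rule summable_on_comparison_test[where f = "\<lambda>j. C * \<bar>x j\<bar>"])
       (use assms in \<open>auto intro!: mult_right_mono summable_on_cmult_right mult_nonneg_nonneg
          simp: col_bounded_def in_l1_def\<close>)
  then have "(\<lambda>j. norm (\<Sum>\<^sub>\<infinity>i\<in>I. \<bar>P i j * x j\<bar>)) summable_on I"
    unfolding * by (simp add: abs_mult)
  moreover have "(\<lambda>i. norm (P i j * x j)) summable_on I" if "j \<in> I" for j
    using in_l1_cmult[OF col_boundedD(1)[OF P that], of "x j"] by (simp add: in_l1_def mult.commute)
  ultimately show ?thesis
    unfolding Infinite_Sum.abs_summable_on_Sigma_iff by simp
qed

lemma mat_vec_summable:
  assumes P: "col_bounded I P C" and x: "in_l1 I x" and i: "i \<in> I"
  shows "(\<lambda>j. P i j * x j) summable_on I"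
proof -
  have "(\<lambda>p. norm (case p of (i, j) \<Rightarrow> P i j * x j)) summable_on I \<times> I"
    using col_bounded_product_summable[OF P x]
      summable_on_swap[of "\<lambda>(j, i). \<bar>P i j * x j\<bar>" I I] by (simp add: case_prod_unfold)
  then show ?thesis
    unfolding Infinite_Sum.abs_summable_on_Sigma_iff using i by (auto intro: abs_summable_summable)
qed

lemma mat_vec_l1:
  assumes P: "col_bounded I P C" and x: "in_l1 I x"
  shows "in_l1 I (mat_vec I P x)" and "l1_norm I (mat_vec I P x) \<le> C * l1_norm I x"
proof -
  have *: "(\<lambda>(j, i). \<bar>P i j * x j\<bar>) summable_on I \<times> I"
    using col_bounded_product_summable[OF P x] by (simp add: case_prod_unfold)
  then have **: "(\<lambda>(i, j). \<bar>P i j * x j\<bar>) summable_on I \<times> I"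
    using summable_on_swap[of "\<lambda>(j, i). \<bar>P i j * x j\<bar>" I I] by (simp add: case_prod_unfold)
  then have row: "(\<lambda>j. \<bar>P i j * x j\<bar>) summable_on I" if "i \<in> I" for i
    using summable_on_SigmaD1[OF ** that] by simp
  have le: "\<bar>mat_vec I P x i\<bar> \<le> (\<Sum>\<^sub>\<infinity>j\<in>I. \<bar>P i j * x j\<bar>)" if "i \<in> I" for i
    unfolding mat_vec_def using norm_infsum_bound[of "\<lambda>j. P i j * x j" I] row[OF that] by simp
  have sum: "(\<lambda>i. \<Sum>\<^sub>\<infinity>j\<in>I. \<bar>P i j * x j\<bar>) summable_on I"
    using summable_on_Sigma_banach[OF **] by simp
  show l1: "in_l1 I (mat_vec I P x)"
    unfolding in_l1_def by (rule summable_on_comparison_test[OF sum]) (use le in auto)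
  have "l1_norm I (mat_vec I P x) \<le> (\<Sum>\<^sub>\<infinity>i\<in>I. \<Sum>\<^sub>\<infinity>j\<in>I. \<bar>P i j * x j\<bar>)"
    unfolding l1_norm_def using l1 sum le by (intro infsum_mono) (auto simp: in_l1_def)
  also have "\<dots> = (\<Sum>\<^sub>\<infinity>j\<in>I. \<Sum>\<^sub>\<infinity>i\<in>I. \<bar>P i j * x j\<bar>)"
    by (rule infsum_swap_banach[OF **])
  also have "\<dots> = (\<Sum>\<^sub>\<infinity>j\<in>I. l1_norm I (\<lambda>i. P i j) * \<bar>x j\<bar>)"
    unfolding l1_norm_def abs_mult by (intro infsum_cong infsum_cmult_left')
  also have "\<dots> \<le> (\<Sum>\<^sub>\<infinity>j\<in>I. C * \<bar>x j\<bar>)"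
  proof (rule infsum_mono)
    show C: "(\<lambda>j. C * \<bar>x j\<bar>) summable_on I"
      using x by (auto intro: summable_on_cmult_right simp: in_l1_def)
    show "(\<lambda>j. l1_norm I (\<lambda>i. P i j) * \<bar>x j\<bar>) summable_on I"
      by (rule summable_on_comparison_test[OF C])
         (use P in \<open>auto intro!: mult_right_mono simp: col_bounded_def\<close>)
  qed (use P in \<open>auto intro!: mult_right_mono simp: col_bounded_def\<close>)
  also have "\<dots> = C * l1_norm I x"
    unfolding l1_norm_def by (rule infsum_cmult_right')
  finally show "l1_norm I (mat_vec I P x) \<le> C * l1_norm I x" .
qed

text \<open>Fubini, in the form that reads sums of \<open>mat_vec I P x\<close> off the columns of
  \<open>P\<close>. With \<open>J\<close> the whole state space it gives conservation of mass, with
  \<open>J\<close> a tail of indices the action of T.\<close>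

lemma infsum_mat_vec:
  assumes P: "col_bounded I P C" and x: "in_l1 I x" and J: "J \<subseteq> I"
  shows "(\<Sum>\<^sub>\<infinity>i\<in>J. mat_vec I P x i) = (\<Sum>\<^sub>\<infinity>j\<in>I. (\<Sum>\<^sub>\<infinity>i\<in>J. P i j) * x j)"
proof -
  have "(\<lambda>(j, i). P i j * x j) summable_on I \<times> I"
    using abs_summable_summable[OF col_bounded_product_summable[OF P x]] .
  then have "(\<lambda>(j, i). P i j * x j) summable_on I \<times> J"
    by (rule summable_on_subset_banach) (use J in auto)
  then have "(\<Sum>\<^sub>\<infinity>j\<in>I. \<Sum>\<^sub>\<infinity>i\<in>J. P i j * x j) = (\<Sum>\<^sub>\<infinity>i\<in>J. \<Sum>\<^sub>\<infinity>j\<in>I. P i j * x j)"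
    by (rule infsum_swap_banach)
  then show ?thesis
    unfolding mat_vec_def by (simp add: infsum_cmult_left')
qed

lemma mat_vec_diff:
  assumes P: "col_bounded I P C" and "in_l1 I x" "in_l1 I y" "i \<in> I"
  shows "mat_vec I P (\<lambda>j. x j - y j) i = mat_vec I P x i - mat_vec I P y i"
proof -
  have "((\<lambda>j. P i j * x j + - (P i j * y j)) has_sum mat_vec I P x i + - mat_vec I P y i) I"
    unfolding mat_vec_def
    by (intro has_sum_add has_sum_uminusI has_sum_infsum mat_vec_summable[OF P] assms)
  from infsumI[OF this] show ?thesis
    by (simp add: mat_vec_def[of _ _ "\<lambda>j. x j - y j"] right_diff_distrib)
qed

section \<open>Single Euler steps and their matrices\<close>

definition euler_step ::
    "nat set \<Rightarrow> (real \<Rightarrow> nat \<Rightarrow> nat \<Rightarrow> real) \<Rightarrow> real \<times> real \<Rightarrow> (nat \<Rightarrow> real) \<Rightarrow> nat \<Rightarrow> real" where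
  "euler_step I M = (\<lambda>(h, r) x i. x i + h * mat_vec I (M r) x i)"

text \<open>I + h M(r) is needed as one matrix: bounding the two terms of a step separately would
  give 1 + h C and lose the effect of the negative diagonal.\<close>

definition euler_matrix :: "(real \<Rightarrow> nat \<Rightarrow> nat \<Rightarrow> real) \<Rightarrow> real \<times> real \<Rightarrow> nat \<Rightarrow> nat \<Rightarrow> real" where
  "euler_matrix M = (\<lambda>(h, r) i j. of_bool (i = j) + h * M r i j)"

lemma euler_step_conv_matrix:
  assumes M: "col_bounded I (M r) C" and x: "in_l1 I x" and i: "i \<in> I"
  shows "euler_step I M (h, r) x i = mat_vec I (euler_matrix M (h, r)) x i"
proof -
  have "((\<lambda>j. of_bool (i = j) * x j) has_sum x i) I"
    by (rule has_sum_finite_neutralI[of "{i}"]) (use i in auto)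
  moreover have "((\<lambda>j. h * (M r i j * x j)) has_sum h * mat_vec I (M r) x i) I"
    unfolding mat_vec_def by (intro has_sum_cmult_right has_sum_infsum mat_vec_summable[OF M x i])
  ultimately have "((\<lambda>j. of_bool (i = j) * x j + h * (M r i j * x j)) has_sum
      x i + h * mat_vec I (M r) x i) I"
    by (rule has_sum_add)
  then have "((\<lambda>j. euler_matrix M (h, r) i j * x j) has_sum euler_step I M (h, r) x i) I"
    by (simp add: euler_matrix_def euler_step_def algebra_simps)
  from infsumI[OF this] show ?thesis
    by (simp add: mat_vec_def)
qed

lemma euler_step_l1:
  assumes M: "col_bounded I (M r) C" and x: "in_l1 I x"
  shows "in_l1 I (euler_step I M (h, r) x)"
  unfolding euler_step_def by (auto intro!: in_l1_add in_l1_cmult x mat_vec_l1[OF M])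

lemma euler_step_norm:
  assumes M: "col_bounded I (M r) C" and E: "col_bounded I (euler_matrix M (h, r)) K" and x: "in_l1 I x"
  shows "l1_norm I (euler_step I M (h, r) x) \<le> K * l1_norm I x"
  using l1_norm_cong[OF euler_step_conv_matrix[of I M, OF M x]] mat_vec_l1(2)[OF E x] by simp

lemma euler_step_nonexpansive:
  assumes M: "col_bounded I (M r) C" and E: "col_bounded I (euler_matrix M (h, r)) 1"
    and x: "in_l1 I x" and z: "in_l1 I z"
  shows "l1_norm I (\<lambda>i. euler_step I M (h, r) x i - euler_step I M (h, r) z i) \<le> l1_norm I (\<lambda>i. x i - z i)"
proof -
  have "l1_norm I (\<lambda>i. euler_step I M (h, r) x i - euler_step I M (h, r) z i) =
      l1_norm I (euler_step I M (h, r) (\<lambda>i. x i - z i))"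
    unfolding euler_step_def
    by (intro l1_norm_cong) (simp add: mat_vec_diff[OF M x z] algebra_simps)
  also have "\<dots> \<le> 1 * l1_norm I (\<lambda>i. x i - z i)"
    by (intro euler_step_norm[of I M r, OF M E] in_l1_diff x z)
  finally show ?thesis by simp
qed

section \<open>Euler products\<close>

text \<open>A straddle estimate: as r lies between u and v, the first-order errors at the two ends
  are small multiples of |u - r| and |v - r|, which add up to v - u. The step applies M(r) to
  \<open>w u\<close> instead of \<open>w r\<close>; this costs v - u times the norm of M(r)(w r - w
  u), which is small near r.\<close>

lemma l1_derivative_step:
  assumes der: "has_l1_derivative I w (mat_vec I (M r) (w r)) r" and M: "col_bounded I (M r) C"
    and w: "\<And>u. 0 \<le> u \<Longrightarrow> in_l1 I (w u)" and r: "0 \<le> r" and e: "0 < e"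
  shows "\<exists>d>0. \<forall>u v. 0 \<le> u \<longrightarrow> u \<le> r \<longrightarrow> r \<le> v \<longrightarrow> v - u < d \<longrightarrow>
    l1_norm I (\<lambda>i. w v i - euler_step I M (v - u, r) (w u) i) \<le> e * (v - u)"
proof -
  define a where "a = mat_vec I (M r) (w r)"
  have a: "in_l1 I a"
    using der by (simp add: has_l1_derivative_def a_def)
  have "((\<lambda>x. l1_norm I (\<lambda>i. (w x i - w r i) / (x - r) - a i)) \<longlongrightarrow> 0) (at r within {0..})"
    using der by (simp add: has_l1_derivative_def a_def)
  then have "\<forall>\<^sub>F x in at r within {0..}. dist (l1_norm I (\<lambda>i. (w x i - w r i) / (x - r) - a i)) 0 < e / 2"
    using e by (intro tendstoD) auto
  then obtain d0 where d0: "d0 > 0"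
    and near: "\<And>x. 0 \<le> x \<Longrightarrow> x \<noteq> r \<Longrightarrow> \<bar>x - r\<bar> < d0 \<Longrightarrow>
      l1_norm I (\<lambda>i. (w x i - w r i) / (x - r) - a i) < e / 2"
    unfolding eventually_at by (auto simp: dist_real_def)
  have rem_l1: "in_l1 I (\<lambda>i. w x i - w r i - (x - r) * a i)" if "0 \<le> x" for x
    by (intro in_l1_diff in_l1_cmult w a that r)
  have rem: "l1_norm I (\<lambda>i. w x i - w r i - (x - r) * a i) \<le> e / 2 * \<bar>x - r\<bar>"
    if x: "0 \<le> x" "\<bar>x - r\<bar> < d0" for x
  proof (cases "x = r")
    case True
    then show ?thesis by (simp add: l1_norm_def)
  next
    case False
    then have "l1_norm I (\<lambda>i. w x i - w r i - (x - r) * a i)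
        = l1_norm I (\<lambda>i. (x - r) * ((w x i - w r i) / (x - r) - a i))"
      by (intro l1_norm_cong) (simp add: field_simps)
    also have "\<dots> \<le> \<bar>x - r\<bar> * (e / 2)"
      unfolding l1_norm_cmult using near[OF x(1) False x(2)] by (intro mult_left_mono) auto
    finally show ?thesis by (simp add: mult.commute)
  qed
  \<comment> \<open>(r - u) K bounds the norm of M(r)(w r - w u): near r the increment of w has norm
    at most (r - u)(e + \<open>l1_norm I a\<close>), and |C| + 1 dominates C while keeping K
    positive.\<close>
  define K where "K = (\<bar>C\<bar> + 1) * (e + l1_norm I a)"
  have K: "K > 0"
    unfolding K_def using e by (intro mult_pos_pos) (auto intro: add_pos_nonneg)
  define d where "d = min d0 (e / (2 * K))"
  have "l1_norm I (\<lambda>i. w v i - euler_step I M (v - u, r) (w u) i) \<le> e * (v - u)"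
    if u: "0 \<le> u" "u \<le> r" "r \<le> v" "v - u < d" for u v
  proof -
    have uv: "0 \<le> v" "\<bar>u - r\<bar> < d0" "\<bar>v - r\<bar> < d0" and small: "r - u < e / (2 * K)"
      using u unfolding d_def by auto
    have diff: "in_l1 I (\<lambda>i. w r i - w u i)"
      by (intro in_l1_diff w r u)
    have "l1_norm I (\<lambda>i. w r i - w u i) = l1_norm I (\<lambda>i. (w u i - w r i - (u - r) * a i) + (u - r) * a i)"
      by (subst l1_norm_diff_commute) simp
    also have "\<dots> \<le> e / 2 * \<bar>u - r\<bar> + \<bar>u - r\<bar> * l1_norm I a"
      using l1_norm_add[OF rem_l1[OF u(1)] in_l1_cmult[OF a, of "u - r"]] rem[OF u(1) uv(2)]
      unfolding l1_norm_cmult by linarith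
    also have "\<dots> \<le> (r - u) * (e + l1_norm I a)"
      using u e mult_left_mono[of "e / 2" e "r - u"] by (simp add: algebra_simps)
    finally have wr: "l1_norm I (\<lambda>i. w r i - w u i) \<le> (r - u) * (e + l1_norm I a)" .
    have "l1_norm I (mat_vec I (M r) (\<lambda>i. w r i - w u i)) \<le> C * l1_norm I (\<lambda>i. w r i - w u i)"
      by (rule mat_vec_l1(2)[OF M diff])
    also have "\<dots> \<le> (\<bar>C\<bar> + 1) * ((r - u) * (e + l1_norm I a))"
      by (intro mult_mono wr) auto
    also have "\<dots> = (r - u) * K"
      by (simp add: K_def)
    also have "\<dots> \<le> e / (2 * K) * K"
      using small K by (intro mult_right_mono) auto
    also have "\<dots> = e / 2"
      using K by simp
    finally have A: "l1_norm I (mat_vec I (M r) (\<lambda>i. w r i - w u i)) \<le> e / 2" .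
    \<comment> \<open>Three errors: the first-order remainders at v and at u, and the replacement of
      \<open>w r\<close> by \<open>w u\<close>.\<close>
    have eq: "w v i - euler_step I M (v - u, r) (w u) i =
        ((w v i - w r i - (v - r) * a i) - (w u i - w r i - (u - r) * a i)) +
        (v - u) * mat_vec I (M r) (\<lambda>i. w r i - w u i) i" if "i \<in> I" for i
      unfolding euler_step_def a_def mat_vec_diff[OF M w[OF r] w[OF u(1)] that]
      by (simp add: algebra_simps)
    have "l1_norm I (\<lambda>i. w v i - euler_step I M (v - u, r) (w u) i) =
      l1_norm I (\<lambda>i. ((w v i - w r i - (v - r) * a i) - (w u i - w r i - (u - r) * a i)) +
        (v - u) * mat_vec I (M r) (\<lambda>i. w r i - w u i) i)"
      by (rule l1_norm_cong[OF eq])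
    also have "\<dots> \<le> l1_norm I (\<lambda>i. (w v i - w r i - (v - r) * a i) - (w u i - w r i - (u - r) * a i)) +
        l1_norm I (\<lambda>i. (v - u) * mat_vec I (M r) (\<lambda>i. w r i - w u i) i)"
      by (intro l1_norm_add in_l1_diff[OF rem_l1 rem_l1] in_l1_cmult mat_vec_l1(1)[OF M diff] uv u)
    also have "\<dots> \<le> (e / 2 * \<bar>v - r\<bar> + e / 2 * \<bar>u - r\<bar>) + \<bar>v - u\<bar> * (e / 2)"
      unfolding l1_norm_cmult
      by (intro add_mono order.trans[OF l1_norm_diff[OF rem_l1 rem_l1]] rem mult_left_mono A uv u) auto
    also have "\<dots> = e * (v - u)"
      using u by (simp add: field_simps)
    finally show ?thesis .
  qed
  moreover have "d > 0"
    unfolding d_def using d0 e K by simp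
  ultimately show ?thesis by blast
qed

section \<open>Tagged partitions as lists in time order\<close>

fun tagged_chain :: "(real \<times> real \<times> real) list \<Rightarrow> real \<Rightarrow> real \<Rightarrow> bool" where
  "tagged_chain [] a b \<longleftrightarrow> a = b"
| "tagged_chain ((\<tau>, u, v) # L) a b \<longleftrightarrow> a = u \<and> u < v \<and> u \<le> \<tau> \<and> \<tau> \<le> v \<and> tagged_chain L v b"

lemma tagged_chain_append:
  "tagged_chain L a b \<Longrightarrow> tagged_chain L' b c \<Longrightarrow> tagged_chain (L @ L') a c"
  by (induction L a b rule: tagged_chain.induct) auto

lemma tagged_chain_le: "tagged_chain L a b \<Longrightarrow> a \<le> b"
  by (induction L a b rule: tagged_chain.induct) auto

lemma tagged_chain_elem:
  "tagged_chain L a b \<Longrightarrow> (\<tau>, u, v) \<in> set L \<Longrightarrow> a \<le> u \<and> u < v \<and> v \<le> b \<and> u \<le> \<tau> \<and> \<tau> \<le> v"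
  by (induction L a b rule: tagged_chain.induct) (fastforce dest: tagged_chain_le)+

text \<open>The intervals of a chain are nondegenerate, so left end points increase strictly. This
  later turns sums over the list into sums over its set.\<close>

lemma tagged_chain_distinct: "tagged_chain L a b \<Longrightarrow> distinct (map (\<lambda>(\<tau>, u, v). u) L)"
  by (induction L a b rule: tagged_chain.induct) (fastforce dest: tagged_chain_elem)+

lemma tagged_chain_inj:
  assumes "tagged_chain L a b"
  shows "inj_on (\<lambda>(\<tau>, u, v). {u..v}) (set L)"
proof (rule inj_onI)
  fix k l assume L: "k \<in> set L" "l \<in> set L"
    and eq: "(\<lambda>(\<tau>, u, v). {u..v}) k = (\<lambda>(\<tau>, u, v). {u..v}) l"
  obtain \<tau> u v \<tau>' u' v' where kl: "k = (\<tau>, u, v)" "l = (\<tau>', u', v')"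
    by (cases k, cases l)
  have "u = u'"
    using eq L tagged_chain_elem[OF assms, of \<tau> u v] tagged_chain_elem[OF assms, of \<tau>' u' v']
    by (auto simp: kl Icc_eq_Icc)
  have inj: "inj_on (\<lambda>(\<tau>, u, v). u) (set L)"
    using tagged_chain_distinct[OF assms] by (simp add: distinct_map)
  show "k = l"
    using inj_onD[OF inj _ L] \<open>u = u'\<close> by (simp add: kl)
qed

text \<open>Euler products need the pieces in time order, hence lists; the Henstock-Kurzweil
  integral is defined through unordered sets of tagged intervals. Here the two views meet.\<close>

lemma tagged_chain_tagged_division:
  "tagged_chain L a b \<Longrightarrow> a < b \<Longrightarrow> (\<lambda>(\<tau>, u, v). (\<tau>, {u..v})) ` set L tagged_division_of {a..b}"
proof (induction L a b rule: tagged_chain.induct)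
  case (2 \<tau> u v L a b)
  have self: "{(\<tau>, {u..v})} tagged_division_of {u..v}"
    using 2 by (intro tagged_division_of_self_real) auto
  show ?case
  proof (cases "v < b")
    case True
    then have "({(\<tau>, {u..v})} \<union> (\<lambda>(\<tau>, u, v). (\<tau>, {u..v})) ` set L) tagged_division_of ({u..v} \<union> {v..b})"
      using 2 by (intro tagged_division_Un self) auto
    moreover have "{u..v} \<union> {v..b} = {a..b}"
      using 2 True by auto
    ultimately show ?thesis by simp
  next
    \<comment> \<open>The induction hypothesis would need v < b. With v = b, nondegeneracy of the
      intervals leaves nothing for the rest of the list.\<close>
    case False
    then have "v = b"
      using 2 tagged_chain_le by force
    moreover have "L = []"
    proof (cases L)
      case (Cons l L')
      obtain \<tau>' u' v' where "l = (\<tau>', u', v')" by (cases l)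
      then have "(\<tau>', u', v') \<in> set L"
        using Cons by simp
      moreover have "tagged_chain L v b"
        using 2(2) by simp
      ultimately have "v \<le> u' \<and> u' < v' \<and> v' \<le> b"
        using tagged_chain_elem by blast
      then show ?thesis
        using \<open>v = b\<close> by linarith
    qed simp
    ultimately show ?thesis
      using 2(2) self \<open>v = b\<close> by simp
  qed
qed simp

text \<open>Cousin's lemma. Bisection reduces it to short intervals around a point x, where the
  single piece tagged by x is fine.\<close>

lemma fine_tagged_chain_exists:
  assumes "a \<le> b" and d: "\<And>x. 0 < d x"
  shows "\<exists>L. tagged_chain L a b \<and> (\<forall>(\<tau>, u, v)\<in>set L. v - u < d \<tau>)"
  using \<open>a \<le> b\<close>
proof (induction rule: Bolzano)
  case (trans a b c)
  then obtain L L' where "tagged_chain L a b" "\<forall>(\<tau>, u, v)\<in>set L. v - u < d \<tau>"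
    "tagged_chain L' b c" "\<forall>(\<tau>, u, v)\<in>set L'. v - u < d \<tau>" by blast
  then show ?case
    by (intro exI[of _ "L @ L'"]) (auto intro: tagged_chain_append)
next
  case (local x)
  have "\<exists>L. tagged_chain L a b \<and> (\<forall>(\<tau>, u, v)\<in>set L. v - u < d \<tau>)"
    if "a \<le> x" "x \<le> b" "b - a < d x" for a b
  proof (cases "a = b")
    case True
    then show ?thesis by (intro exI[of _ "[]"]) simp
  next
    case False
    then show ?thesis using that by (intro exI[of _ "[(x, a, b)]"]) auto
  qed
  then show ?case using d by blast
qed

section \<open>Products of Euler steps along a tagged partition\<close>

definition euler :: "nat set \<Rightarrow> (real \<Rightarrow> nat \<Rightarrow> nat \<Rightarrow> real) \<Rightarrow> (real \<times> real) list \<Rightarrow> (nat \<Rightarrow> real) \<Rightarrow> nat \<Rightarrow> real" where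
  "euler I M = fold (euler_step I M)"

text \<open>Tags in \<open>E\<close> are those at which the derivative may fail. Their intervals are
  left out altogether, so the step lengths may add up to less than the length of the partitioned
  interval.\<close>

definition good_steps :: "real set \<Rightarrow> (real \<times> real \<times> real) list \<Rightarrow> (real \<times> real) list" where
  "good_steps E L = map (\<lambda>(\<tau>, u, v). (v - u, \<tau>)) (filter (\<lambda>l. fst l \<notin> E) L)"

lemma good_steps_simps [simp]:
  "good_steps E [] = []"
  "good_steps E ((\<tau>, u, v) # L) = (if \<tau> \<in> E then good_steps E L else (v - u, \<tau>) # good_steps E L)"
  by (auto simp: good_steps_def)

lemma euler_simps [simp]:
  "euler I M [] x = x"
  "euler I M (p # L) x = euler I M L (euler_step I M p x)"
  by (simp_all add: euler_def)

text \<open>Every later step is nonexpansive, so local errors travel to the end without growth and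
  simply add up. On a skipped interval the product stands still and the local error is the increment
  of \<open>w\<close>. The start vector \<open>y\<close> is arbitrary because the induction moves it
  along the product.\<close>

lemma euler_chain_error:
  assumes "tagged_chain L a b"
    and M: "\<And>\<tau> u v. (\<tau>, u, v) \<in> set L \<Longrightarrow> col_bounded I (M \<tau>) (C \<tau>)"
    and contr: "\<And>\<tau> u v. (\<tau>, u, v) \<in> set L \<Longrightarrow> \<tau> \<notin> E \<Longrightarrow> col_bounded I (euler_matrix M (v - u, \<tau>)) 1"
    and w: "\<And>u. a \<le> u \<Longrightarrow> in_l1 I (w u)" and y: "in_l1 I y"
    and err: "\<And>\<tau> u v. (\<tau>, u, v) \<in> set L \<Longrightarrow> \<tau> \<notin> E \<Longrightarrow>
      l1_norm I (\<lambda>i. w v i - euler_step I M (v - u, \<tau>) (w u) i) \<le> e * (v - u)"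
    and e: "0 \<le> e"
  shows "l1_norm I (\<lambda>i. w b i - euler I M (good_steps E L) y i) \<le>
    l1_norm I (\<lambda>i. w a i - y i) +
    (\<Sum>(\<tau>, u, v)\<leftarrow>filter (\<lambda>l. fst l \<in> E) L. l1_norm I (\<lambda>i. w v i - w u i)) + e * (b - a)"
  using assms(1) M contr w y err
proof (induction L a b arbitrary: y rule: tagged_chain.induct)
  case (1 a b)
  then show ?case by simp
next
  case (2 \<tau> u v L a b)
  from 2(2) have uv: "a = u" "u < v" and chain: "tagged_chain L v b" by auto
  have w: "in_l1 I (w u)" "in_l1 I (w v)"
    using 2(5) uv by auto
  show ?case
  proof (cases "\<tau> \<in> E")
    case True
    have "l1_norm I (\<lambda>i. w b i - euler I M (good_steps E L) y i) \<le>
      l1_norm I (\<lambda>i. w v i - y i) +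
      (\<Sum>(\<tau>, u, v)\<leftarrow>filter (\<lambda>l. fst l \<in> E) L. l1_norm I (\<lambda>i. w v i - w u i)) + e * (b - v)"
      by (rule 2(1)) (use 2 uv in auto)
    moreover have "l1_norm I (\<lambda>i. w v i - y i) \<le>
        l1_norm I (\<lambda>i. w v i - w u i) + l1_norm I (\<lambda>i. w u i - y i)"
      by (intro l1_norm_triangle in_l1_diff w \<open>in_l1 I y\<close>)
    moreover have "e * (b - v) \<le> e * (b - u)"
      using uv e by (intro mult_left_mono) auto
    ultimately show ?thesis
      using True uv by simp
  next
    case False
    define S where "S = euler_step I M (v - u, \<tau>)"
    have M\<tau>: "col_bounded I (M \<tau>) (C \<tau>)" and E\<tau>: "col_bounded I (euler_matrix M (v - u, \<tau>)) 1"
      using 2(3)[of \<tau> u v] 2(4)[of \<tau> u v] False by auto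
    have Sl1: "in_l1 I x \<Longrightarrow> in_l1 I (S x)" for x
      unfolding S_def by (rule euler_step_l1[of I M \<tau>, OF M\<tau>])
    have "l1_norm I (\<lambda>i. w b i - euler I M (good_steps E L) (S y) i) \<le>
      l1_norm I (\<lambda>i. w v i - S y i) +
      (\<Sum>(\<tau>, u, v)\<leftarrow>filter (\<lambda>l. fst l \<in> E) L. l1_norm I (\<lambda>i. w v i - w u i)) + e * (b - v)"
      by (rule 2(1)) (use 2 uv Sl1 in auto)
    moreover have "l1_norm I (\<lambda>i. w v i - S y i) \<le>
        l1_norm I (\<lambda>i. w v i - S (w u) i) + l1_norm I (\<lambda>i. S (w u) i - S y i)"
      by (intro l1_norm_triangle in_l1_diff Sl1 w \<open>in_l1 I y\<close>)
    moreover have "l1_norm I (\<lambda>i. w v i - S (w u) i) \<le> e * (v - u)"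
      unfolding S_def using False by (intro 2(7)[of \<tau>]) auto
    moreover have "l1_norm I (\<lambda>i. S (w u) i - S y i) \<le> l1_norm I (\<lambda>i. w u i - y i)"
      unfolding S_def by (rule euler_step_nonexpansive[of I M \<tau>, OF M\<tau> E\<tau> w(1) \<open>in_l1 I y\<close>])
    moreover have "e * (b - v) + e * (v - u) = e * (b - u)"
      by (simp add: algebra_simps)
    ultimately show ?thesis
      using False uv by (simp add: S_def)
  qed
qed

text \<open>The function \<open>g\<close> is carried along because one and the same partition must
  bring the product close to \<open>w t\<close> and the Riemann sum of the decay rate close to its
  integral.\<close>

theorem euler_approximation:
  assumes sol: "l1_solution I M w" and st: "0 \<le> s" "s \<le> t"
    and M: "\<And>r. 0 \<le> r \<Longrightarrow> col_bounded I (M r) (C r)"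
    and hmax: "\<And>r. 0 \<le> r \<Longrightarrow> 0 < hmax r"
    and contr: "\<And>r h. 0 \<le> r \<Longrightarrow> 0 \<le> h \<Longrightarrow> h \<le> hmax r \<Longrightarrow> col_bounded I (euler_matrix M (h, r)) 1"
    and g: "(g has_integral G) {s..t}" and e: "0 < e"
  shows "\<exists>L. (\<forall>h r. (h, r) \<in> set L \<longrightarrow> 0 \<le> r \<and> 0 \<le> h \<and> h \<le> hmax r) \<and>
    \<bar>(\<Sum>(h, r)\<leftarrow>L. h * g r) - G\<bar> < e \<and>
    l1_norm I (\<lambda>i. w t i - euler I M L (w s) i) \<le> e"
proof (cases "s = t")
  case True
  then have "G = 0"
    using g by (metis content_real_if has_integral_null_real has_integral_unique order_refl diff_self)
  with True show ?thesis
    using e by (intro exI[of _ "[]"]) (auto simp: l1_norm_def)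
next
  case False
  with st have st': "s < t" "0 < t" by auto
  have w: "\<And>u. 0 \<le> u \<Longrightarrow> in_l1 I (w u)"
    using sol by (simp add: l1_solution_def)
  obtain E where E: "negligible E" and
    der: "\<And>r. r \<notin> E \<Longrightarrow> 0 \<le> r \<Longrightarrow> has_l1_derivative I w (mat_vec I (M r) (w r)) r"
    using sol unfolding l1_solution_def eventually_ae_filter_negligible by blast
  obtain \<eta> where \<eta>: "\<eta> > 0" and ac: "\<And>D. D division_of \<Union>D \<Longrightarrow> \<Union>D \<subseteq> {0..t} \<Longrightarrow>
      (\<Sum>K\<in>D. Sup K - Inf K) < \<eta> \<Longrightarrow> (\<Sum>K\<in>D. l1_norm I (\<lambda>i. w (Sup K) i - w (Inf K) i)) < e / 2"
    using sol[unfolded l1_solution_def locally_l1_abs_cont_def, THEN conjunct2, THEN conjunct1,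
      rule_format, of t "e / 2"] st' e by auto
  \<comment> \<open>Intervals with tags in \<open>E\<close> will be kept inside \<open>U\<close>, so
    that their total length stays below the \<eta> of absolute continuity.\<close>
  obtain U where U: "open U" "E \<subseteq> U" "U \<in> lmeasurable" "measure lebesgue U < \<eta>"
  proof -
    obtain U where U: "open U" "E \<subseteq> U" "U - E \<in> lmeasurable" "emeasure lebesgue (U - E) < ennreal \<eta>"
      using sets_lebesgue_outer_open[of E \<eta>] E \<eta> by (auto simp: negligible_iff_null_sets)
    have E0: "E \<in> null_sets lebesgue"
      using E by (simp add: negligible_iff_null_sets)
    have "U = (U - E) \<union> E" using U by auto
    then have "U \<in> lmeasurable"
      using U(3) E by (metis fmeasurable.Un negligible_imp_measurable)
    moreover have "measure lebesgue U = measure lebesgue (U - E)"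
      using \<open>U \<in> lmeasurable\<close> E0 by (simp add: measure_Diff_null_set fmeasurableD)
    moreover have "measure lebesgue (U - E) < \<eta>"
      using U(3,4) \<eta> by (simp add: emeasure_eq_measure2 ennreal_less_iff)
    ultimately show ?thesis
      using U that by simp
  qed
  \<comment> \<open>Setting \<open>g\<close> to 0 on the null set \<open>E\<close> keeps the
    integral and makes skipped tags contribute nothing to the Riemann sum.\<close>
  define g' where "g' = (\<lambda>r. if r \<in> E then 0 else g r)"
  have "(g' has_integral G) {s..t}"
    by (rule has_integral_spike[OF E _ g]) (simp add: g'_def)
  then obtain \<gamma> where \<gamma>: "gauge \<gamma>" and riemann: "\<And>D. D tagged_division_of {s..t} \<Longrightarrow> \<gamma> fine D \<Longrightarrow>
      norm ((\<Sum>(x, k)\<in>D. measure lborel k *\<^sub>R g' x) - G) < e"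
    unfolding has_integral_real using e by meson
  \<comment> \<open>The steps with good tags may cost e' (t - s) = e / 2; the other half is reserved
    for the skipped intervals.\<close>
  define e' where "e' = e / (2 * (t - s))"
  have e': "e' > 0" unfolding e'_def using e st' by simp
  \<comment> \<open>A single length bound per tag must serve four purposes: fineness for the
    integral, containment in \<open>U\<close>, the step limit \<open>hmax\<close>, and the straddle
    estimate.\<close>
  define ok where "ok = (\<lambda>r d.
      (\<forall>u v. u \<le> r \<longrightarrow> r \<le> v \<longrightarrow> v - u < d \<longrightarrow> {u..v} \<subseteq> \<gamma> r \<and> (r \<in> E \<longrightarrow> {u..v} \<subseteq> U)) \<and>
      (0 \<le> r \<longrightarrow> r \<notin> E \<longrightarrow> d \<le> hmax r \<and> (\<forall>u v. 0 \<le> u \<longrightarrow> u \<le> r \<longrightarrow> r \<le> v \<longrightarrow> v - u < d \<longrightarrow>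
        l1_norm I (\<lambda>i. w v i - euler_step I M (v - u, r) (w u) i) \<le> e' * (v - u))))"
  have "\<exists>d>0. ok r d" for r
  proof -
    obtain d1 where d1: "d1 > 0" "ball r d1 \<subseteq> \<gamma> r"
      using \<gamma> unfolding gauge_def by (meson openE)
    obtain d2 where d2: "d2 > 0" "r \<in> E \<longrightarrow> ball r d2 \<subseteq> U"
      using U(1,2) by (metis openE subsetD zero_less_one)
    obtain d3 where d3: "d3 > 0" "0 \<le> r \<longrightarrow> r \<notin> E \<longrightarrow> d3 \<le> hmax r \<and>
      (\<forall>u v. 0 \<le> u \<longrightarrow> u \<le> r \<longrightarrow> r \<le> v \<longrightarrow> v - u < d3 \<longrightarrow>
        l1_norm I (\<lambda>i. w v i - euler_step I M (v - u, r) (w u) i) \<le> e' * (v - u))"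
    proof (cases "0 \<le> r \<and> r \<notin> E")
      case True
      from l1_derivative_step[of I w M r "C r" e', OF der M w _ e'] True obtain d where d: "d > 0"
        "\<And>u v. 0 \<le> u \<Longrightarrow> u \<le> r \<Longrightarrow> r \<le> v \<Longrightarrow> v - u < d \<Longrightarrow>
          l1_norm I (\<lambda>i. w v i - euler_step I M (v - u, r) (w u) i) \<le> e' * (v - u)"
        by blast
      show ?thesis
        by (rule that[of "min d (hmax r)"]) (use d hmax True in auto)
    qed (use that[of 1] in auto)
    have sub: "{u..v} \<subseteq> ball r d" if "u \<le> r" "r \<le> v" "v - u < d" for u v d
      using that by (auto simp: dist_real_def)
    show ?thesis
      unfolding ok_def
    proof (intro exI[of _ "min d1 (min d2 d3)"] conjI allI impI)
      fix u v assume uv: "u \<le> r" "r \<le> v" "v - u < min d1 (min d2 d3)"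
      show "{u..v} \<subseteq> \<gamma> r"
        using sub[of u v d1] uv d1 by auto
      show "{u..v} \<subseteq> U" if "r \<in> E"
        using sub[of u v d2] uv d2 that by auto
    next
      assume r: "0 \<le> r" "r \<notin> E"
      show "min d1 (min d2 d3) \<le> hmax r"
        using d3 r by auto
      show "l1_norm I (\<lambda>i. w v i - euler_step I M (v - u, r) (w u) i) \<le> e' * (v - u)"
        if "0 \<le> u" "u \<le> r" "r \<le> v" "v - u < min d1 (min d2 d3)" for u v
        using d3(2) r that by simp
    qed (use d1 d2 d3 in simp)
  qed
  then obtain d where d: "\<And>r. d r > 0" and ok: "\<And>r. ok r (d r)"
    by metis
  have d\<gamma>: "\<And>r u v. u \<le> r \<Longrightarrow> r \<le> v \<Longrightarrow> v - u < d r \<Longrightarrow> {u..v} \<subseteq> \<gamma> r"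
    and dU: "\<And>r u v. u \<le> r \<Longrightarrow> r \<le> v \<Longrightarrow> v - u < d r \<Longrightarrow> r \<in> E \<Longrightarrow> {u..v} \<subseteq> U"
    and dh: "\<And>r. 0 \<le> r \<Longrightarrow> r \<notin> E \<Longrightarrow> d r \<le> hmax r"
    and dstep: "\<And>r u v. 0 \<le> r \<Longrightarrow> r \<notin> E \<Longrightarrow> 0 \<le> u \<Longrightarrow> u \<le> r \<Longrightarrow> r \<le> v \<Longrightarrow> v - u < d r \<Longrightarrow>
        l1_norm I (\<lambda>i. w v i - euler_step I M (v - u, r) (w u) i) \<le> e' * (v - u)"
    using ok unfolding ok_def by blast+
  obtain L where L: "tagged_chain L s t" and fine: "\<And>\<tau> u v. (\<tau>, u, v) \<in> set L \<Longrightarrow> v - u < d \<tau>"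
    using fine_tagged_chain_exists[OF st(2), of d] d by blast
  note elem = tagged_chain_elem[OF L]
  have dist: "distinct L"
    using tagged_chain_distinct[OF L] by (simp add: distinct_map)
  define p where "p = (\<lambda>(\<tau>, u, v). (\<tau>, {u..v})) ` set L"
  have inj: "inj_on (\<lambda>(\<tau>, u, v). {u..v}) A" if "A \<subseteq> set L" for A
    using tagged_chain_inj[OF L] that by (rule inj_on_subset)
  have inj_p: "inj_on (\<lambda>(\<tau>, u, v). (\<tau>, {u..v})) (set L)"
    using inj[OF order_refl] unfolding inj_on_def by fastforce
  have p: "p tagged_division_of {s..t}"
    unfolding p_def by (rule tagged_chain_tagged_division[OF L st'(1)])
  show ?thesis
  proof (intro exI[of _ "good_steps E L"] conjI)
    show "\<forall>h r. (h, r) \<in> set (good_steps E L) \<longrightarrow> 0 \<le> r \<and> 0 \<le> h \<and> h \<le> hmax r"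
    proof (intro allI impI)
      fix h r assume "(h, r) \<in> set (good_steps E L)"
      then obtain u v where "(r, u, v) \<in> set L" "h = v - u" "r \<notin> E"
        by (auto simp: good_steps_def)
      with elem[of r u v] fine[of r u v] dh[of r] st show "0 \<le> r \<and> 0 \<le> h \<and> h \<le> hmax r" by auto
    qed
    have "\<gamma> fine p"
    proof (rule fineI)
      fix x k assume "(x, k) \<in> p"
      then obtain u v where l: "(x, u, v) \<in> set L" and k: "k = {u..v}"
        by (auto simp: p_def)
      show "k \<subseteq> \<gamma> x"
        unfolding k using elem[OF l] fine[OF l] by (intro d\<gamma>) auto
    qed
    note R = riemann[OF p this]
    have "(\<Sum>(h, r)\<leftarrow>good_steps E L. h * g r) = (\<Sum>(\<tau>, u, v)\<leftarrow>L. (v - u) * g' \<tau>)"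
      by (induction L) (auto simp: g'_def)
    also have "\<dots> = (\<Sum>(\<tau>, u, v)\<in>set L. (v - u) * g' \<tau>)"
      by (rule sum_list_distinct_conv_sum_set[OF dist])
    also have "\<dots> = (\<Sum>(x, k)\<in>p. measure lborel k *\<^sub>R g' x)"
      unfolding p_def sum.reindex[OF inj_p]
      by (intro sum.cong refl) (auto dest!: elem)
    finally show "\<bar>(\<Sum>(h, r)\<leftarrow>good_steps E L. h * g r) - G\<bar> < e"
      using R by simp
    define LE where "LE = filter (\<lambda>l. fst l \<in> E) L"
    \<comment> \<open>Absolute continuity speaks of sets of intervals. Distinct members of a chain
      have distinct intervals, so passing to the set loses no increment.\<close>
    define D where "D = (\<lambda>(\<tau>, u, v). {u..v}) ` set LE"
    have LE: "set LE \<subseteq> set L" "distinct LE"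
      unfolding LE_def using dist by auto
    have "D \<subseteq> snd ` p"
      unfolding D_def p_def LE_def by force
    then have D: "D division_of \<Union>D"
      using division_of_tagged_division[OF p] by (metis division_ofD(6) division_of_subset)
    have "K \<subseteq> U \<and> K \<subseteq> {0..t} \<and> Sup K - Inf K = measure lebesgue K" if "K \<in> D" for K
    proof -
      from that obtain \<tau> u v where l: "(\<tau>, u, v) \<in> set L" "\<tau> \<in> E" and K: "K = {u..v}"
        by (auto simp: D_def LE_def)
      show ?thesis
        unfolding K using elem[OF l(1)] fine[OF l(1)] st dU[OF _ _ _ l(2), of u v] by auto
    qed
    then have D_U: "\<Union>D \<subseteq> U" and D_st: "\<Union>D \<subseteq> {0..t}"
      and D_len: "\<And>K. K \<in> D \<Longrightarrow> Sup K - Inf K = measure lebesgue K"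
      by blast+
    have "(\<Sum>K\<in>D. Sup K - Inf K) = (\<Sum>K\<in>D. measure lebesgue K)"
      by (intro sum.cong D_len) auto
    also have "\<dots> = measure lebesgue (\<Union>D)"
      by (rule content_division[OF D])
    also have "\<dots> \<le> measure lebesgue U"
      using D_U U lmeasurable_division[OF D] by (intro measure_mono_fmeasurable) (auto simp: fmeasurableD)
    finally have "(\<Sum>K\<in>D. Sup K - Inf K) < \<eta>"
      using U by simp
    then have "(\<Sum>K\<in>D. l1_norm I (\<lambda>i. w (Sup K) i - w (Inf K) i)) < e / 2"
      by (rule ac[OF D D_st])
    also have "(\<Sum>K\<in>D. l1_norm I (\<lambda>i. w (Sup K) i - w (Inf K) i)) =
        (\<Sum>(\<tau>, u, v)\<in>set LE. l1_norm I (\<lambda>i. w v i - w u i))"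
      unfolding D_def sum.reindex[OF inj[OF LE(1)]] using LE(1)
      by (intro sum.cong refl) (auto dest!: subsetD elem simp: less_imp_le)
    also have "\<dots> = (\<Sum>(\<tau>, u, v)\<leftarrow>LE. l1_norm I (\<lambda>i. w v i - w u i))"
      by (rule sum_list_distinct_conv_sum_set[OF LE(2), symmetric])
    finally have bad: "(\<Sum>(\<tau>, u, v)\<leftarrow>LE. l1_norm I (\<lambda>i. w v i - w u i)) < e / 2" .
    have "l1_norm I (\<lambda>i. w t i - euler I M (good_steps E L) (w s) i) \<le>
      l1_norm I (\<lambda>i. w s i - w s i) + (\<Sum>(\<tau>, u, v)\<leftarrow>LE. l1_norm I (\<lambda>i. w v i - w u i)) + e' * (t - s)"
      unfolding LE_def
    proof (rule euler_chain_error[OF L])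
      fix \<tau> u v assume l: "(\<tau>, u, v) \<in> set L"
      note b = elem[OF l] fine[OF l] st
      show "col_bounded I (M \<tau>) (C \<tau>)"
        using b by (intro M) auto
      show "col_bounded I (euler_matrix M (v - u, \<tau>)) 1" if "\<tau> \<notin> E"
        using b dh[OF _ that] by (intro contr) fastforce+
      show "l1_norm I (\<lambda>i. w v i - euler_step I M (v - u, \<tau>) (w u) i) \<le> e' * (v - u)" if "\<tau> \<notin> E"
        using b that by (intro dstep) auto
    qed (use w st e' in auto)
    also have "e' * (t - s) = e / 2"
      unfolding e'_def using st' by (simp add: field_simps)
    also have "l1_norm I (\<lambda>i. w s i - w s i) = 0"
      by (simp add: l1_norm_def)
    finally show "l1_norm I (\<lambda>i. w t i - euler I M (good_steps E L) (w s) i) \<le> e"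
      using bad by simp
  qed
qed

text \<open>The invariant \<open>Q\<close>, the functional \<open>N\<close> and the rate
  \<open>g\<close> stay abstract because three cases are needed: the weighted norm on zero-sum
  vectors, the plain norm with rate 0, and the system of \<open>B_star_star\<close>. The exponent is
  a sum of h g(r) so that it can be compared with an integral.\<close>

lemma euler_decay:
  assumes "Q x" and "\<And>h r. (h, r) \<in> set L \<Longrightarrow> P h r"
    and step: "\<And>h r x. P h r \<Longrightarrow> Q x \<Longrightarrow> Q (euler_step I M (h, r) x) \<and>
      N (euler_step I M (h, r) x) \<le> exp (- h * g r) * N x"
  shows "Q (euler I M L x) \<and> N (euler I M L x) \<le> exp (- (\<Sum>(h, r)\<leftarrow>L. h * g r)) * N x"
  using assms(1,2)
proof (induction L arbitrary: x)
  case (Cons p L)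
  obtain h r where p: "p = (h, r)" by (cases p)
  define x' where "x' = euler_step I M (h, r) x"
  have x': "Q x'" "N x' \<le> exp (- h * g r) * N x"
    using step[of h r x] Cons.prems p by (auto simp: x'_def)
  have "Q (euler I M L x') \<and> N (euler I M L x') \<le> exp (- (\<Sum>(h, r)\<leftarrow>L. h * g r)) * N x'"
    using Cons x' by auto
  moreover have "exp (- (\<Sum>(h, r)\<leftarrow>L. h * g r)) * N x' \<le>
      exp (- (\<Sum>(h, r)\<leftarrow>L. h * g r)) * (exp (- h * g r) * N x)"
    using x' by (intro mult_left_mono) auto
  moreover have "exp (- (\<Sum>(h, r)\<leftarrow>L. h * g r)) * exp (- h * g r) = exp (- (\<Sum>(h, r)\<leftarrow>p # L. h * g r))"
    unfolding exp_add[symmetric] by (simp add: p)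
  ultimately have "Q (euler I M L x') \<and> N (euler I M L x') \<le> exp (- (\<Sum>(h, r)\<leftarrow>p # L. h * g r)) * N x"
    by (simp only: mult.assoc[symmetric]) (blast intro: order.trans)
  then show ?case
    by (simp add: p x'_def)
qed simp

section \<open>The matrices of the queue\<close>

text \<open>Column norms of the concrete matrices are estimated this way: the entries are dominated
  by an explicit family with a known sum.\<close>

lemma l1_norm_le_has_sum:
  assumes g: "(g has_sum S) I" and le: "\<And>i. i \<in> I \<Longrightarrow> \<bar>x i\<bar> \<le> g i"
  shows "in_l1 I x \<and> l1_norm I x \<le> S"
proof (rule l1_bounded_finite_sums)
  fix F assume F: "finite F" "F \<subseteq> I"
  then have "(\<Sum>i\<in>F. \<bar>x i\<bar>) \<le> sum g F"
    by (intro sum_mono le) auto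
  also have "\<dots> \<le> S"
  proof (rule finite_sum_le_has_sum[OF g F])
    show "0 \<le> g i" if "i \<in> I - F" for i
      using le[of i] that by (meson DiffD1 abs_ge_zero order.trans)
  qed
  finally show "(\<Sum>i\<in>F. \<bar>x i\<bar>) \<le> S" .
qed

text \<open>Linearity allows two state distributions to be compared through one solution of the same
  system.\<close>

lemma l1_solution_diff:
  assumes M: "\<And>r. 0 \<le> r \<Longrightarrow> col_bounded I (M r) (C r)"
    and p: "l1_solution I M p" and p': "l1_solution I M p'"
  shows "l1_solution I M (\<lambda>t i. p t i - p' t i)"
  unfolding l1_solution_def
proof (intro conjI allI impI)
  have pl: "in_l1 I (p t)" and pl': "in_l1 I (p' t)" if "0 \<le> t" for t
    using p p' that by (auto simp: l1_solution_def)
  show "in_l1 I (\<lambda>i. p t i - p' t i)" if "0 \<le> t" for t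
    by (intro in_l1_diff pl pl' that)
  show "locally_l1_abs_cont I (\<lambda>t i. p t i - p' t i)"
    unfolding locally_l1_abs_cont_def
  proof (intro allI impI)
    fix \<tau> \<epsilon> :: real assume "0 < \<tau>" "0 < \<epsilon>"
    then obtain \<eta> \<eta>' where \<eta>: "\<eta> > 0" "\<eta>' > 0"
      and ac: "\<And>D. D division_of \<Union>D \<Longrightarrow> \<Union>D \<subseteq> {0..\<tau>} \<Longrightarrow>
        (\<Sum>K\<in>D. Sup K - Inf K) < \<eta> \<Longrightarrow> (\<Sum>K\<in>D. l1_norm I (\<lambda>i. p (Sup K) i - p (Inf K) i)) < \<epsilon> / 2"
      and ac': "\<And>D. D division_of \<Union>D \<Longrightarrow> \<Union>D \<subseteq> {0..\<tau>} \<Longrightarrow>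
        (\<Sum>K\<in>D. Sup K - Inf K) < \<eta>' \<Longrightarrow> (\<Sum>K\<in>D. l1_norm I (\<lambda>i. p' (Sup K) i - p' (Inf K) i)) < \<epsilon> / 2"
      using p[unfolded l1_solution_def locally_l1_abs_cont_def, THEN conjunct2, THEN conjunct1,
          rule_format, of \<tau> "\<epsilon> / 2"]
        p'[unfolded l1_solution_def locally_l1_abs_cont_def, THEN conjunct2, THEN conjunct1,
          rule_format, of \<tau> "\<epsilon> / 2"] by auto
    show "\<exists>\<eta>>0. \<forall>D. D division_of \<Union>D \<longrightarrow> \<Union>D \<subseteq> {0..\<tau>} \<longrightarrow> (\<Sum>K\<in>D. Sup K - Inf K) < \<eta> \<longrightarrow>
      (\<Sum>K\<in>D. l1_norm I (\<lambda>i. p (Sup K) i - p' (Sup K) i - (p (Inf K) i - p' (Inf K) i))) < \<epsilon>"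
    proof (intro exI[of _ "min \<eta> \<eta>'"] conjI allI impI)
      fix D :: "real set set"
      assume D: "D division_of \<Union>D" "\<Union>D \<subseteq> {0..\<tau>}" "(\<Sum>K\<in>D. Sup K - Inf K) < min \<eta> \<eta>'"
      have "l1_norm I (\<lambda>i. p (Sup K) i - p' (Sup K) i - (p (Inf K) i - p' (Inf K) i)) \<le>
        l1_norm I (\<lambda>i. p (Sup K) i - p (Inf K) i) + l1_norm I (\<lambda>i. p' (Sup K) i - p' (Inf K) i)"
        if KD: "K \<in> D" for K
      proof -
        \<comment> \<open>Membership in l1 is known at nonnegative times only, so the end points of
          K have to be located in [0, \<tau>].\<close>
        obtain u v where K: "K = {u..v}" "K \<noteq> {}"
          using division_ofD(3,4)[OF D(1) KD] by (metis box_real(2))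
        moreover have "K \<subseteq> {0..\<tau>}"
          using D(2) KD by blast
        ultimately have "0 \<le> Sup K" "0 \<le> Inf K"
          by auto
        then have "l1_norm I (\<lambda>i. (p (Sup K) i - p (Inf K) i) - (p' (Sup K) i - p' (Inf K) i)) \<le>
          l1_norm I (\<lambda>i. p (Sup K) i - p (Inf K) i) + l1_norm I (\<lambda>i. p' (Sup K) i - p' (Inf K) i)"
          by (intro l1_norm_diff in_l1_diff pl pl')
        then show ?thesis
          by (simp add: algebra_simps)
      qed
      then have "(\<Sum>K\<in>D. l1_norm I (\<lambda>i. p (Sup K) i - p' (Sup K) i - (p (Inf K) i - p' (Inf K) i))) \<le>
        (\<Sum>K\<in>D. l1_norm I (\<lambda>i. p (Sup K) i - p (Inf K) i)) +
        (\<Sum>K\<in>D. l1_norm I (\<lambda>i. p' (Sup K) i - p' (Inf K) i))"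
        unfolding sum.distrib[symmetric] by (rule sum_mono)
      also have "\<dots> < \<epsilon> / 2 + \<epsilon> / 2"
        using D by (intro add_strict_mono ac ac') auto
      finally show "(\<Sum>K\<in>D. l1_norm I (\<lambda>i. p (Sup K) i - p' (Sup K) i - (p (Inf K) i - p' (Inf K) i))) < \<epsilon>"
        by simp
    qed (use \<eta> in simp)
  qed
  have der: "has_l1_derivative I (\<lambda>t i. p t i - p' t i) (mat_vec I (M t) (\<lambda>i. p t i - p' t i)) t"
    if t: "0 \<le> t" and d: "has_l1_derivative I p (mat_vec I (M t) (p t)) t"
      and d': "has_l1_derivative I p' (mat_vec I (M t) (p' t)) t" for t
    unfolding has_l1_derivative_def
  proof
    show "in_l1 I (mat_vec I (M t) (\<lambda>i. p t i - p' t i))"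
      by (intro mat_vec_l1(1)[OF M] in_l1_diff pl pl' t)
    define q where "q = (\<lambda>s i. (p s i - p t i) / (s - t) - mat_vec I (M t) (p t) i)"
    define q' where "q' = (\<lambda>s i. (p' s i - p' t i) / (s - t) - mat_vec I (M t) (p' t) i)"
    have ql: "in_l1 I (q s)" and ql': "in_l1 I (q' s)" if "0 \<le> s" for s
      using in_l1_diff[OF in_l1_cmult[OF in_l1_diff[OF pl[OF that] pl[OF t]], of "inverse (s - t)"]
          mat_vec_l1(1)[OF M pl], of t t]
        in_l1_diff[OF in_l1_cmult[OF in_l1_diff[OF pl'[OF that] pl'[OF t]], of "inverse (s - t)"]
          mat_vec_l1(1)[OF M pl'], of t t] t
      by (simp_all add: q_def q'_def divide_inverse mult.commute)
    have eq: "(p s i - p' s i - (p t i - p' t i)) / (s - t) - mat_vec I (M t) (\<lambda>i. p t i - p' t i) i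
        = q s i - q' s i" if "i \<in> I" for s i
      unfolding q_def q'_def mat_vec_diff[OF M[OF t] pl[OF t] pl'[OF t] that]
      by (simp add: diff_divide_distrib)
    have lim: "((\<lambda>s. l1_norm I (q s) + l1_norm I (q' s)) \<longlongrightarrow> 0) (at t within {0..})"
      using tendsto_add[of _ 0 _ _ 0] d d' unfolding has_l1_derivative_def q_def q'_def by auto
    have "((\<lambda>s. l1_norm I (\<lambda>i. q s i - q' s i)) \<longlongrightarrow> 0) (at t within {0..})"
    proof (rule tendsto_sandwich[OF _ _ tendsto_const lim])
      show "\<forall>\<^sub>F s in at t within {0..}. l1_norm I (\<lambda>i. q s i - q' s i) \<le> l1_norm I (q s) + l1_norm I (q' s)"
        unfolding eventually_at_topological by (auto intro!: l1_norm_diff ql ql' exI[of _ UNIV])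
    qed auto
    then show "((\<lambda>s. l1_norm I (\<lambda>i. (p s i - p' s i - (p t i - p' t i)) / (s - t) -
        mat_vec I (M t) (\<lambda>i. p t i - p' t i) i)) \<longlongrightarrow> 0) (at t within {0..})"
      using l1_norm_cong[OF eq] by simp
  qed
  have "AE t in lebesgue. 0 \<le> t \<longrightarrow> has_l1_derivative I p (mat_vec I (M t) (p t)) t"
    "AE t in lebesgue. 0 \<le> t \<longrightarrow> has_l1_derivative I p' (mat_vec I (M t) (p' t)) t"
    using p p' by (simp_all add: l1_solution_def)
  then show "AE t in lebesgue. 0 \<le> t \<longrightarrow>
      has_l1_derivative I (\<lambda>t i. p t i - p' t i) (mat_vec I (M t) (\<lambda>i. p t i - p' t i)) t"
    by eventually_elim (auto intro: der)
qed

lemma pmf_has_sum: "(pmf b has_sum measure_pmf.prob b A) A"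
proof -
  have "pmf b summable_on A"
    using pmf_abs_summable[of b A] abs_summable_equivalent[of "pmf b" A]
    by (auto intro: Infinite_Sum.abs_summable_summable)
  moreover have "infsum (pmf b) A = measure_pmf.prob b A"
    by (simp add: measure_pmf_conv_infsetsum infsetsum_infsum pmf_abs_summable)
  ultimately show ?thesis
    by (metis has_sum_infsum)
qed

section \<open>The forward matrix: column sums and contraction\<close>

locale batch_queue =
  fixes lam mu :: "real \<Rightarrow> real" and b :: "nat pmf"
  assumes lam_nonneg: "0 \<le> t \<Longrightarrow> 0 \<le> lam t" and mu_nonneg: "0 \<le> t \<Longrightarrow> 0 \<le> mu t"
    and batch_pos: "0 \<notin> set_pmf b"
begin

abbreviation "X \<equiv> states b"
abbreviation "Y \<equiv> pos_states b"
abbreviation "A \<equiv> forward_matrix lam mu b"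

lemma states_downward: "i \<in> X \<Longrightarrow> j \<le> i \<Longrightarrow> j \<in> X"
  by (auto simp: states_def split: if_splits)

lemma zero_in_states: "0 \<in> X"
  by (simp add: states_def)

lemma pmf_outside_states: "i \<notin> X \<Longrightarrow> pmf b i = 0"
  by (auto simp: states_def pmf_eq_0_set_pmf split: if_splits)

lemma batch_tail_prob: "batch_tail b k = measure_pmf.prob b {k..}"
  unfolding batch_tail_def by (rule infsumI) (rule pmf_has_sum)

lemma batch_tail_bounds: "0 \<le> batch_tail b k" "batch_tail b k \<le> 1"
  by (simp_all add: batch_tail_prob)

text \<open>Batches are nonempty. Thus the exceptional diagonal entry -lambda of state 0 equals
  -lambda B_1 and fits the pattern of the other diagonal entries.\<close>

lemma batch_tail_1: "batch_tail b (Suc 0) = 1"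
proof -
  have "AE n in measure_pmf b. n \<in> {Suc 0..}"
    unfolding AE_measure_pmf_iff using batch_pos by (auto simp: Suc_le_eq intro: gr0I)
  then show ?thesis
    by (simp add: batch_tail_prob measure_pmf.prob_eq_1)
qed

text \<open>Restricting to the state space loses no mass, as \<open>pmf b\<close> vanishes outside
  it. This is what lets finite and infinite state spaces be treated alike.\<close>

lemma batch_tail_has_sum: "(pmf b has_sum batch_tail b k) {i \<in> X. k \<le> i}"
proof -
  have "(pmf b has_sum batch_tail b k) {k..}"
    unfolding batch_tail_prob by (rule pmf_has_sum)
  then show ?thesis
    by (subst has_sum_cong_neutral[of "{k..}"]) (auto simp: pmf_outside_states)
qed

text \<open>Arrivals, service and diagonal are separated because each has an elementary sum over the
  part of a column below a given level.\<close>

lemma forward_matrix_parts: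
  "A r i j = lam r * (if j < i then pmf b i else 0) + ((if Suc i = j then mu r else 0) +
    (if i = j then - ((if j = 0 then 0 else mu r) + lam r * batch_tail b (Suc j)) else 0))"
  by (auto simp: forward_matrix_def intensity_def batch_tail_1)

lemma forward_parts_has_sum:
  assumes "j \<in> X"
  shows "((\<lambda>i. lam r * (if j < i then pmf b i else 0)) has_sum lam r * batch_tail b (max k (Suc j)))
      {i \<in> X. k \<le> i}"
    and "((\<lambda>i. if Suc i = j then c else 0) has_sum (if k < j then c else 0)) {i \<in> X. k \<le> i}"
    and "((\<lambda>i. if i = j then c else 0) has_sum (if k \<le> j then c else 0)) {i \<in> X. k \<le> i}"
proof -
  have "(pmf b has_sum batch_tail b (max k (Suc j))) {i \<in> X. max k (Suc j) \<le> i}"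
    by (rule batch_tail_has_sum)
  then have "((\<lambda>i. if j < i then pmf b i else 0) has_sum batch_tail b (max k (Suc j))) {i \<in> X. k \<le> i}"
    by (subst has_sum_cong_neutral[of "{i \<in> X. max k (Suc j) \<le> i}" _ "pmf b"]) auto
  then show "((\<lambda>i. lam r * (if j < i then pmf b i else 0)) has_sum lam r * batch_tail b (max k (Suc j)))
      {i \<in> X. k \<le> i}"
    by (rule has_sum_cmult_right)
  show "((\<lambda>i. if Suc i = j then c else 0) has_sum (if k < j then c else 0)) {i \<in> X. k \<le> i}"
    by (rule has_sum_finite_neutralI[of "if k < j then {j - 1} else {}"])
      (use assms in \<open>auto split: if_splits intro: states_downward[of j]\<close>)
  show "((\<lambda>i. if i = j then c else 0) has_sum (if k \<le> j then c else 0)) {i \<in> X. k \<le> i}"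
    by (rule has_sum_finite_neutralI[of "if k \<le> j then {j} else {}"])
      (use assms in \<open>auto split: if_splits\<close>)
qed

text \<open>These are the entries of T A. From j < k a batch reaches the levels from k on at rate
  lambda B_k, whatever j is; at j = k a service leaves them; from j > k neither event does. For k =
  0 the sum is a full column, which vanishes.\<close>

lemma forward_column_tail_sum:
  assumes "j \<in> X"
  shows "((\<lambda>i. A r i j) has_sum
    (if k = 0 then 0 else if j < k then lam r * batch_tail b k else if j = k then - mu r else 0))
    {i \<in> X. k \<le> i}"
proof -
  let ?d = "- ((if j = 0 then 0 else mu r) + lam r * batch_tail b (Suc j))"
  have "((\<lambda>i. A r i j) has_sum lam r * batch_tail b (max k (Suc j)) +
      ((if k < j then mu r else 0) + (if k \<le> j then ?d else 0))) {i \<in> X. k \<le> i}"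
    unfolding forward_matrix_parts by (intro has_sum_add forward_parts_has_sum assms)
  also have "lam r * batch_tail b (max k (Suc j)) + ((if k < j then mu r else 0) + (if k \<le> j then ?d else 0)) =
    (if k = 0 then 0 else if j < k then lam r * batch_tail b k else if j = k then - mu r else 0)"
    by (cases "k = Suc j") (auto simp: max_def not_le)
  finally show ?thesis .
qed

text \<open>The outflow rate of a state is at most lambda + mu and occurs twice in its column: on
  the diagonal, and distributed over the other rows.\<close>

lemma forward_col_bounded:
  assumes r: "0 \<le> r"
  shows "col_bounded X (A r) (2 * (lam r + mu r))"
  unfolding col_bounded_def
proof
  fix j assume j: "j \<in> X"
  let ?d = "(if j = 0 then 0 else mu r) + lam r * batch_tail b (Suc j)"
  have "in_l1 X (\<lambda>i. A r i j) \<and> l1_norm X (\<lambda>i. A r i j) \<le>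
    lam r * batch_tail b (max 0 (Suc j)) + ((if 0 < j then mu r else 0) + (if 0 \<le> j then ?d else 0))"
  proof (rule l1_norm_le_has_sum)
    have "((\<lambda>i. lam r * (if j < i then pmf b i else 0) + ((if Suc i = j then mu r else 0) +
        (if i = j then ?d else 0))) has_sum
      lam r * batch_tail b (max 0 (Suc j)) + ((if 0 < j then mu r else 0) + (if 0 \<le> j then ?d else 0)))
      {i \<in> X. 0 \<le> i}"
      by (intro has_sum_add forward_parts_has_sum j)
    then show "((\<lambda>i. lam r * (if j < i then pmf b i else 0) + ((if Suc i = j then mu r else 0) +
        (if i = j then ?d else 0))) has_sum
      lam r * batch_tail b (max 0 (Suc j)) + ((if 0 < j then mu r else 0) + (if 0 \<le> j then ?d else 0))) X"
      by simp
    have "0 \<le> lam r * batch_tail b (Suc j)"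
      using lam_nonneg[OF r] batch_tail_bounds by simp
    then show "\<bar>A r i j\<bar> \<le> lam r * (if j < i then pmf b i else 0) + ((if Suc i = j then mu r else 0) +
        (if i = j then ?d else 0))" for i
      using lam_nonneg[OF r] mu_nonneg[OF r] unfolding forward_matrix_parts by (auto simp: abs_mult)
  qed
  moreover have "lam r * batch_tail b (Suc j) \<le> lam r"
    using lam_nonneg[OF r] batch_tail_bounds by (simp add: mult_left_le)
  ultimately show "in_l1 X (\<lambda>i. A r i j) \<and> l1_norm X (\<lambda>i. A r i j) \<le> 2 * (lam r + mu r)"
    using mu_nonneg[OF r] lam_nonneg[OF r] by (auto split: if_splits)
qed

text \<open>Below this step length the diagonals of I + h A(r) and of its counterpart for
  \<open>B_star_star\<close> are nonnegative. The summand 1 covers vanishing intensities.\<close>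

definition "max_step r = 1 / (1 + lam r + mu r)"

lemma max_step_pos: "0 \<le> r \<Longrightarrow> 0 < max_step r"
  using lam_nonneg[of r] mu_nonneg[of r] by (simp add: max_step_def)

lemma max_stepD:
  assumes "0 \<le> r" "0 \<le> h" "h \<le> max_step r"
  shows "h * (mu r + lam r * batch_tail b k) \<le> 1"
proof -
  have "h * (mu r + lam r * batch_tail b k) \<le> h * (1 + lam r + mu r)"
    using lam_nonneg[of r] mu_nonneg[of r] batch_tail_bounds[of k] assms
      mult_left_le[of "batch_tail b k" "lam r"]
    by (intro mult_left_mono) auto
  also have "\<dots> \<le> 1"
    using assms lam_nonneg[of r] mu_nonneg[of r] by (simp add: max_step_def field_simps)
  finally show ?thesis .
qed

text \<open>For such h the matrix I + h A(r) has nonnegative entries and columns summing to 1, so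
  the norm of a column is its sum.\<close>

lemma forward_euler_contraction:
  assumes r: "0 \<le> r" and h: "0 \<le> h" "h \<le> max_step r"
  shows "col_bounded X (euler_matrix A (h, r)) 1"
  unfolding col_bounded_def
proof
  fix j assume j: "j \<in> X"
  show "in_l1 X (\<lambda>i. euler_matrix A (h, r) i j) \<and> l1_norm X (\<lambda>i. euler_matrix A (h, r) i j) \<le> 1"
  proof (rule l1_norm_le_has_sum)
    have "((\<lambda>i. A r i j) has_sum 0) X"
      using forward_column_tail_sum[OF j, of r 0] by simp
    moreover have "((\<lambda>i. of_bool (i = j)) has_sum (1::real)) X"
      by (rule has_sum_finite_neutralI[of "{j}"]) (use j in auto)
    ultimately have "((\<lambda>i. of_bool (i = j) + h * A r i j) has_sum 1 + h * 0) X"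
      by (intro has_sum_add has_sum_cmult_right)
    then show "((\<lambda>i. euler_matrix A (h, r) i j) has_sum 1) X"
      by (simp add: euler_matrix_def)
    have "h * (lam r * batch_tail b (Suc j)) \<le> h * (mu r + lam r * batch_tail b (Suc j))"
      using h mu_nonneg[OF r] by (intro mult_left_mono) auto
    also note max_stepD[OF r h, of "Suc j"]
    finally show "\<bar>euler_matrix A (h, r) i j\<bar> \<le> euler_matrix A (h, r) i j" for i
      using max_stepD[OF r h, of "Suc j"] h lam_nonneg[OF r] mu_nonneg[OF r]
      unfolding euler_matrix_def forward_matrix_parts
      by (auto simp: batch_tail_1 algebra_simps)
  qed
qed

text \<open>The coordinates of T x, extended to index 0, where the value is the total sum of
  x.\<close>

definition "tail_sum x i = infsum x {j \<in> X. i \<le> j}"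

lemma tail_sum_outside: "i \<notin> X \<Longrightarrow> tail_sum x i = 0"
  unfolding tail_sum_def by (rule infsum_0) (auto dest: states_downward)

lemma tail_sum_Suc:
  assumes x: "in_l1 X x" and i: "i \<in> X"
  shows "tail_sum x i = x i + tail_sum x (Suc i)"
proof -
  have "{j \<in> X. i \<le> j} = insert i {j \<in> X. Suc i \<le> j}"
    using i by auto
  moreover have "x summable_on {j \<in> X. Suc i \<le> j}"
    by (rule summable_on_subset_banach[OF in_l1_summable[OF x]]) auto
  ultimately show ?thesis
    by (simp add: tail_sum_def infsum_insert)
qed

text \<open>The column sums over a tail yield lambda B_i times the mass below i, minus mu x_i. Zero
  total sum turns that mass into minus the tail at i, and x_i is the difference of two consecutive
  tails.\<close>

lemma tail_sum_forward:
  assumes r: "0 \<le> r" and x: "in_l1 X x" and zero: "infsum x X = 0" and i: "i \<in> Y"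
  shows "tail_sum (mat_vec X (A r) x) i =
    - (mu r + lam r * batch_tail b i) * tail_sum x i + mu r * tail_sum x (Suc i)"
proof -
  have i': "i \<in> X" "0 < i"
    using i by (auto simp: pos_states_def)
  have sub: "x summable_on S" if "S \<subseteq> X" for S
    by (rule summable_on_subset_banach[OF in_l1_summable[OF x] that])
  have "infsum x ({j \<in> X. j < i} \<union> {j \<in> X. i \<le> j}) = infsum x {j \<in> X. j < i} + tail_sum x i"
    unfolding tail_sum_def by (intro infsum_Un_disjoint sub) auto
  also have "{j \<in> X. j < i} \<union> {j \<in> X. i \<le> j} = X"
    by auto
  finally have low: "infsum x {j \<in> X. j < i} = - tail_sum x i"
    using zero by simp
  have "((\<lambda>j. if j < i then x j else 0) has_sum - tail_sum x i) X"
    using has_sum_infsum[OF sub, of "{j \<in> X. j < i}"] unfolding low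
    by (subst has_sum_cong_neutral[of "{j \<in> X. j < i}" _ x]) auto
  moreover have "((\<lambda>j. if j = i then x j else 0) has_sum x i) X"
    by (rule has_sum_finite_neutralI[of "{i}"]) (use i' in auto)
  ultimately have "((\<lambda>j. lam r * batch_tail b i * (if j < i then x j else 0) +
      - mu r * (if j = i then x j else 0)) has_sum
      lam r * batch_tail b i * (- tail_sum x i) + - mu r * x i) X"
    by (intro has_sum_add has_sum_cmult_right)
  note infsumI[OF this]
  moreover have "tail_sum (mat_vec X (A r) x) i = (\<Sum>\<^sub>\<infinity>j\<in>X. (\<Sum>\<^sub>\<infinity>k\<in>{k \<in> X. i \<le> k}. A r k j) * x j)"
    unfolding tail_sum_def by (rule infsum_mat_vec[OF forward_col_bounded[OF r] x]) auto
  moreover have "\<dots> = (\<Sum>\<^sub>\<infinity>j\<in>X. lam r * batch_tail b i * (if j < i then x j else 0) +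
      - mu r * (if j = i then x j else 0))"
    by (intro infsum_cong) (use i' in \<open>auto simp: infsumI[OF forward_column_tail_sum]\<close>)
  ultimately show ?thesis
    using tail_sum_Suc[OF x i'(1)] by (simp add: algebra_simps)
qed

lemma infsum_euler_step:
  assumes r: "0 \<le> r" and x: "in_l1 X x"
  shows "infsum (euler_step X A (h, r) x) X = infsum x X"
proof -
  have "infsum (mat_vec X (A r) x) X = (\<Sum>\<^sub>\<infinity>j\<in>X. (\<Sum>\<^sub>\<infinity>i\<in>X. A r i j) * x j)"
    by (rule infsum_mat_vec[OF forward_col_bounded[OF r] x]) auto
  also have "\<dots> = (\<Sum>\<^sub>\<infinity>j\<in>X. 0)"
    using infsumI[OF forward_column_tail_sum, of _ r 0] by (intro infsum_cong) simp
  finally have "infsum (mat_vec X (A r) x) X = 0" by simp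
  moreover have "infsum (euler_step X A (h, r) x) X = infsum x X + infsum (\<lambda>i. h * mat_vec X (A r) x i) X"
    unfolding euler_step_def prod.case
    by (intro infsum_add in_l1_summable x in_l1_cmult mat_vec_l1[OF forward_col_bounded[OF r] x])
  ultimately show ?thesis
    by (simp add: infsum_cmult_right')
qed

end

section \<open>Weighted tail sums and the conjugated system\<close>

locale weighted_batch_queue = batch_queue +
  fixes \<delta> :: real
  assumes \<delta>: "0 < \<delta>" "\<delta> < 1"
begin

abbreviation "BB \<equiv> B_star_star lam mu b \<delta>"

lemma weight_pos: "0 < weight \<delta> k"
  using \<delta> by (simp add: weight_def)

lemma weight_ge_1: "1 \<le> weight \<delta> k"
  using \<delta> unfolding weight_def by (intro one_le_power) (simp add: one_le_inverse)

lemma B_star_star_entries: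
  assumes "i \<in> Y"
  shows "BB r i j = (if i = j then - (mu r + lam r * batch_tail b i) else if j = Suc i then \<delta> * mu r else 0)"
proof -
  \<comment> \<open>Truncated subtraction gives indices 0 and 1 the same weight, so consecutive
    weights have ratio \<delta> only from index 1 on.\<close>
  have "weight \<delta> i * mu r * inverse (weight \<delta> (Suc i)) = \<delta> * mu r"
    using assms \<delta> by (cases i) (auto simp: weight_def pos_states_def)
  then show ?thesis
    using weight_pos[of i] by (auto simp: B_star_star_def B_star_def)
qed

text \<open>A column j meets the rows j and j - 1 only, and for j = 1 the second of them is row 0,
  which lies outside \<open>Y\<close>.\<close>

lemma B_star_star_column:
  assumes "j \<in> Y"
  shows "((\<lambda>i. if i = j then c else if j = Suc i then d else 0) has_sum
    c + (if j = Suc 0 then 0 else d)) Y"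
  by (rule has_sum_finite_neutralI[of "if j = Suc 0 then {j} else {j, j - 1}"])
    (use assms in \<open>auto simp: pos_states_def intro: states_downward[of j] split: if_splits\<close>)

lemma B_star_star_col_bounded:
  assumes r: "0 \<le> r"
  shows "col_bounded Y (BB r) (lam r + 2 * mu r)"
  unfolding col_bounded_def
proof
  fix j assume j: "j \<in> Y"
  let ?c = "mu r + lam r * batch_tail b j"
  have c: "0 \<le> ?c" "?c \<le> mu r + lam r"
    using lam_nonneg[OF r] mu_nonneg[OF r] batch_tail_bounds[of j] by (auto simp: mult_left_le)
  have d: "0 \<le> \<delta> * mu r" "\<delta> * mu r \<le> mu r"
    using \<delta> mu_nonneg[OF r] by (auto simp: mult_left_le_one_le)
  have "in_l1 Y (\<lambda>i. BB r i j) \<and> l1_norm Y (\<lambda>i. BB r i j) \<le> ?c + (if j = Suc 0 then 0 else \<delta> * mu r)"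
    by (rule l1_norm_le_has_sum[OF B_star_star_column[OF j]]) (use c d in \<open>auto simp: B_star_star_entries\<close>)
  then show "in_l1 Y (\<lambda>i. BB r i j) \<and> l1_norm Y (\<lambda>i. BB r i j) \<le> lam r + 2 * mu r"
    using c d mu_nonneg[OF r] by (auto split: if_splits)
qed

text \<open>With a nonnegative diagonal the norm of column j is at most 1 - h (mu + lambda B_j) + h
  \<delta> mu; discarding lambda B_j leaves the claimed factor.\<close>

lemma B_star_star_euler_contraction:
  assumes r: "0 \<le> r" and h: "0 \<le> h" "h \<le> max_step r"
  shows "col_bounded Y (euler_matrix BB (h, r)) (1 - h * ((1 - \<delta>) * mu r))"
  unfolding col_bounded_def
proof
  fix j assume j: "j \<in> Y"
  let ?c = "1 - h * (mu r + lam r * batch_tail b j)"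
  have c: "0 \<le> ?c" "?c \<le> 1 - h * mu r"
    using max_stepD[OF r h, of j] h lam_nonneg[OF r] batch_tail_bounds[of j]
    by (auto simp: distrib_left)
  have d: "0 \<le> h * (\<delta> * mu r)"
    using \<delta> h mu_nonneg[OF r] by simp
  have "in_l1 Y (\<lambda>i. euler_matrix BB (h, r) i j) \<and>
      l1_norm Y (\<lambda>i. euler_matrix BB (h, r) i j) \<le> ?c + (if j = Suc 0 then 0 else h * (\<delta> * mu r))"
    by (rule l1_norm_le_has_sum[OF B_star_star_column[OF j]])
      (use c d in \<open>auto simp: euler_matrix_def B_star_star_entries algebra_simps\<close>)
  moreover have "?c + (if j = Suc 0 then 0 else h * (\<delta> * mu r)) \<le> 1 - h * ((1 - \<delta>) * mu r)"
    using c d by (auto simp: algebra_simps)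
  ultimately show "in_l1 Y (\<lambda>i. euler_matrix BB (h, r) i j) \<and>
      l1_norm Y (\<lambda>i. euler_matrix BB (h, r) i j) \<le> 1 - h * ((1 - \<delta>) * mu r)"
    by linarith
qed

lemma B_star_star_euler_step:
  assumes r: "0 \<le> r" and h: "0 \<le> h" "h \<le> max_step r" and x: "in_l1 Y x"
  shows "in_l1 Y (euler_step Y BB (h, r) x)"
    and "l1_norm Y (euler_step Y BB (h, r) x) \<le> exp (- h * ((1 - \<delta>) * mu r)) * l1_norm Y x"
proof -
  show "in_l1 Y (euler_step Y BB (h, r) x)"
    by (rule euler_step_l1[of Y BB r, OF B_star_star_col_bounded[OF r] x])
  have "l1_norm Y (euler_step Y BB (h, r) x) \<le> (1 - h * ((1 - \<delta>) * mu r)) * l1_norm Y x"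
    by (rule euler_step_norm[of Y BB r, OF B_star_star_col_bounded[OF r] B_star_star_euler_contraction[OF r h] x])
  also have "\<dots> \<le> exp (- h * ((1 - \<delta>) * mu r)) * l1_norm Y x"
    using exp_ge_add_one_self[of "- h * ((1 - \<delta>) * mu r)"] by (intro mult_right_mono) auto
  finally show "l1_norm Y (euler_step Y BB (h, r) x) \<le> exp (- h * ((1 - \<delta>) * mu r)) * l1_norm Y x" .
qed

lemma mat_vec_B_star_star:
  assumes i: "i \<in> Y"
  shows "mat_vec Y (BB r) y i = - (mu r + lam r * batch_tail b i) * y i +
    (if Suc i \<in> Y then \<delta> * mu r * y (Suc i) else 0)"
  unfolding mat_vec_def
  by (rule infsumI, rule has_sum_finite_neutralI[of "if Suc i \<in> Y then {i, Suc i} else {i}"])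
    (use i in \<open>auto simp: B_star_star_entries split: if_splits\<close>)

lemma DT_conv_tail_sum:
  assumes "i \<in> Y"
  shows "DT Y \<delta> x i = weight \<delta> i * tail_sum x i"
proof -
  have "mat_vec Y T_mat x i = tail_sum x i"
    unfolding mat_vec_def tail_sum_def T_mat_def
    by (rule infsum_cong_neutral) (use assms in \<open>auto simp: pos_states_def\<close>)
  then show ?thesis by (simp add: DT_def)
qed

lemma abs_tail_sum_le:
  assumes "i \<in> Y"
  shows "\<bar>tail_sum x i\<bar> \<le> \<bar>DT Y \<delta> x i\<bar>"
  using mult_right_mono[OF weight_ge_1[of i], of "\<bar>tail_sum x i\<bar>"] weight_pos[of i]
  unfolding DT_conv_tail_sum[OF assms] by (simp add: abs_mult)

text \<open>On zero-sum vectors the tails obey the bidiagonal system of \<open>B_star\<close>;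
  multiplying by \<open>weight \<delta> i\<close>, which is \<delta> times the next weight, puts the
  factor \<delta> on the superdiagonal.\<close>

lemma DT_euler_step:
  assumes r: "0 \<le> r" and x: "in_l1 X x" and zero: "infsum x X = 0" and i: "i \<in> Y"
  shows "DT Y \<delta> (euler_step X A (h, r) x) i = euler_step Y BB (h, r) (DT Y \<delta> x) i"
proof -
  have i': "i \<in> X" "0 < i"
    using i by (auto simp: pos_states_def)
  have Ax: "in_l1 X (mat_vec X (A r) x)"
    by (rule mat_vec_l1[OF forward_col_bounded[OF r] x])
  have "x summable_on {j \<in> X. i \<le> j}" "(\<lambda>i. h * mat_vec X (A r) x i) summable_on {j \<in> X. i \<le> j}"
    using in_l1_summable[OF in_l1_subset[OF x]] in_l1_summable[OF in_l1_subset[OF in_l1_cmult[OF Ax]]]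
    by auto
  then have "tail_sum (euler_step X A (h, r) x) i = tail_sum x i + tail_sum (\<lambda>i. h * mat_vec X (A r) x i) i"
    unfolding tail_sum_def euler_step_def prod.case
    by (rule infsum_add)
  also have "tail_sum (\<lambda>i. h * mat_vec X (A r) x i) i = h * tail_sum (mat_vec X (A r) x) i"
    unfolding tail_sum_def by (rule infsum_cmult_right')
  finally have step: "tail_sum (euler_step X A (h, r) x) i = tail_sum x i + h *
      (- (mu r + lam r * batch_tail b i) * tail_sum x i + mu r * tail_sum x (Suc i))"
    unfolding tail_sum_forward[OF r x zero i] .
  have Suc_in: "Suc i \<in> Y \<longleftrightarrow> Suc i \<in> X"
    by (simp add: pos_states_def)
  have "\<delta> * weight \<delta> (Suc i) = weight \<delta> i"
    using i' \<delta> by (cases i) (auto simp: weight_def)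
  \<comment> \<open>In a finite state space the last row has no superdiagonal entry; this agrees
    with the tail sum, which is 0 beyond the last state.\<close>
  then have "(if Suc i \<in> Y then \<delta> * mu r * DT Y \<delta> x (Suc i) else 0) = weight \<delta> i * mu r * tail_sum x (Suc i)"
    using tail_sum_outside[of "Suc i" x] Suc_in by (auto simp: DT_conv_tail_sum)
  then show ?thesis
    unfolding DT_conv_tail_sum[OF i] step euler_step_def[of Y] prod.case mat_vec_B_star_star[OF i]
    by (simp add: algebra_simps)
qed

text \<open>The vectors for which \<open>DT_euler_step\<close> applies and the weighted norm is a
  genuine sum. Euler steps preserve the class.\<close>

definition "tame x \<longleftrightarrow> in_l1 X x \<and> infsum x X = 0 \<and> in_l1 Y (DT Y \<delta> x)"

lemma tame_euler_step:
  assumes r: "0 \<le> r" and h: "0 \<le> h" "h \<le> max_step r" and x: "tame x"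
  shows "tame (euler_step X A (h, r) x) \<and>
    l1_norm Y (DT Y \<delta> (euler_step X A (h, r) x)) \<le> exp (- h * ((1 - \<delta>) * mu r)) * l1_norm Y (DT Y \<delta> x)"
proof -
  have x': "in_l1 X x" "infsum x X = 0" "in_l1 Y (DT Y \<delta> x)"
    using x by (auto simp: tame_def)
  let ?x' = "euler_step X A (h, r) x"
  have "in_l1 Y (DT Y \<delta> ?x') \<longleftrightarrow> in_l1 Y (euler_step Y BB (h, r) (DT Y \<delta> x))"
    by (intro in_l1_cong DT_euler_step r x'(1,2))
  moreover have "l1_norm Y (DT Y \<delta> ?x') = l1_norm Y (euler_step Y BB (h, r) (DT Y \<delta> x))"
    by (intro l1_norm_cong DT_euler_step r x'(1,2))
  ultimately show ?thesis
    using B_star_star_euler_step[OF r h x'(3)] euler_step_l1[of X A r, OF forward_col_bounded[OF r] x'(1)]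
      infsum_euler_step[OF r x'(1), of h] x'(2)
    unfolding tame_def by simp
qed

text \<open>Each x_i is a difference of two consecutive tails, which gives the factor 2, and the
  weights are at least 1.\<close>

lemma l1_norm_le_DT:
  assumes x: "tame x"
  shows "l1_norm X x \<le> 2 * l1_norm Y (DT Y \<delta> x)"
proof -
  have x': "in_l1 X x" "infsum x X = 0" "in_l1 Y (DT Y \<delta> x)"
    using x by (auto simp: tame_def)
  have tail: "(\<Sum>i\<in>F. \<bar>tail_sum x i\<bar>) \<le> l1_norm Y (DT Y \<delta> x)" if F: "finite F" for F
  proof -
    \<comment> \<open>Index 0 has no counterpart in \<open>DT Y \<delta> x\<close>, but its tail is
      the total sum, which is 0; other indices outside \<open>Y\<close> lie beyond the last
      state.\<close>
    have "tail_sum x i = 0" if "i \<in> F - Y" for i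
      using that x'(2) tail_sum_outside[of i x] by (auto simp: pos_states_def tail_sum_def)
    then have "(\<Sum>i\<in>F. \<bar>tail_sum x i\<bar>) = (\<Sum>i\<in>F \<inter> Y. \<bar>tail_sum x i\<bar>)"
      using F by (intro sum.mono_neutral_right) auto
    also have "\<dots> \<le> (\<Sum>i\<in>F \<inter> Y. \<bar>DT Y \<delta> x i\<bar>)"
      by (intro sum_mono abs_tail_sum_le) auto
    also have "\<dots> \<le> l1_norm Y (DT Y \<delta> x)"
      by (rule finite_sum_le_l1_norm[OF x'(3)]) (use F in auto)
    finally show ?thesis .
  qed
  have "(\<Sum>i\<in>F. \<bar>x i\<bar>) \<le> 2 * l1_norm Y (DT Y \<delta> x)" if F: "finite F" "F \<subseteq> X" for F
  proof -
    have "(\<Sum>i\<in>F. \<bar>x i\<bar>) \<le> (\<Sum>i\<in>F. \<bar>tail_sum x i\<bar> + \<bar>tail_sum x (Suc i)\<bar>)"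
    proof (rule sum_mono)
      fix i assume "i \<in> F"
      then show "\<bar>x i\<bar> \<le> \<bar>tail_sum x i\<bar> + \<bar>tail_sum x (Suc i)\<bar>"
        using tail_sum_Suc[OF x'(1), of i] F by auto
    qed
    also have "\<dots> = (\<Sum>i\<in>F. \<bar>tail_sum x i\<bar>) + (\<Sum>i\<in>Suc ` F. \<bar>tail_sum x i\<bar>)"
      by (simp add: sum.distrib sum.reindex)
    also have "\<dots> \<le> 2 * l1_norm Y (DT Y \<delta> x)"
      using tail[of F] tail[of "Suc ` F"] F by simp
    finally show ?thesis .
  qed
  then show ?thesis
    using l1_bounded_finite_sums by blast
qed

lemma tame_euler:
  assumes x: "tame x" and L: "\<And>h r. (h, r) \<in> set L \<Longrightarrow> 0 \<le> r \<and> 0 \<le> h \<and> h \<le> max_step r"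
  shows "tame (euler X A L x)"
    and "l1_norm Y (DT Y \<delta> (euler X A L x)) \<le>
      exp (- (\<Sum>(h, r)\<leftarrow>L. h * ((1 - \<delta>) * mu r))) * l1_norm Y (DT Y \<delta> x)"
  using euler_decay[of tame x L "\<lambda>h r. 0 \<le> r \<and> 0 \<le> h \<and> h \<le> max_step r" X A
      "\<lambda>x. l1_norm Y (DT Y \<delta> x)" "\<lambda>r. (1 - \<delta>) * mu r", OF x L] tame_euler_step by auto

end

section \<open>Decay of solutions\<close>

context batch_queue
begin

lemma forward_approximation:
  assumes "l1_solution X A y" "0 \<le> s" "s \<le> t" "(g has_integral G) {s..t}" "0 < e"
  shows "\<exists>L. (\<forall>h r. (h, r) \<in> set L \<longrightarrow> 0 \<le> r \<and> 0 \<le> h \<and> h \<le> max_step r) \<and>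
    \<bar>(\<Sum>(h, r)\<leftarrow>L. h * g r) - G\<bar> < e \<and>
    l1_norm X (\<lambda>i. y t i - euler X A L (y s) i) \<le> e"
  by (rule euler_approximation[OF assms(1-3) _ _ _ assms(4,5),
        where hmax = max_step and C = "\<lambda>r. 2 * (lam r + mu r)"])
    (rule forward_col_bounded max_step_pos forward_euler_contraction; assumption)+

lemma euler_l1:
  assumes "in_l1 X x" and L: "\<And>h r. (h, r) \<in> set L \<Longrightarrow> 0 \<le> r \<and> 0 \<le> h \<and> h \<le> max_step r"
  shows "in_l1 X (euler X A L x)" "infsum (euler X A L x) X = infsum x X"
    "l1_norm X (euler X A L x) \<le> l1_norm X x"
proof -
  have "(in_l1 X (euler X A L x) \<and> infsum (euler X A L x) X = infsum x X) \<and>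
    l1_norm X (euler X A L x) \<le> exp (- (\<Sum>(h, r)\<leftarrow>L. h * 0)) * l1_norm X x"
  \<comment> \<open>With rate 0 the exponential factor is 1, so the plain norm does not increase;
    mass conservation is part of the invariant.\<close>
  proof (rule euler_decay[where P = "\<lambda>h r. 0 \<le> r \<and> 0 \<le> h \<and> h \<le> max_step r"])
    fix h r z assume P: "0 \<le> r \<and> 0 \<le> h \<and> h \<le> max_step r"
      and z: "in_l1 X z \<and> infsum z X = infsum x X"
    have "l1_norm X (euler_step X A (h, r) z) \<le> 1 * l1_norm X z"
      by (rule euler_step_norm[of X A r, OF forward_col_bounded forward_euler_contraction]) (use P z in auto)
    then show "(in_l1 X (euler_step X A (h, r) z) \<and> infsum (euler_step X A (h, r) z) X = infsum x X) \<and>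
        l1_norm X (euler_step X A (h, r) z) \<le> exp (- h * 0) * l1_norm X z"
      using P z euler_step_l1[of X A r, OF forward_col_bounded, of z h] infsum_euler_step[of r z h] by simp
  qed (use assms in auto)
  then show "in_l1 X (euler X A L x)" "infsum (euler X A L x) X = infsum x X"
    "l1_norm X (euler X A L x) \<le> l1_norm X x"
    by (simp_all add: case_prod_unfold)
qed

text \<open>Every Euler step preserves the total sum, and the total sum is continuous in the
  l1-norm, so no termwise differentiation of the series is needed. The function 0 is a dummy
  integrand.\<close>

lemma infsum_solution_conserved:
  assumes y: "l1_solution X A y" and t: "0 \<le> t"
  shows "infsum (y t) X = infsum (y 0) X"
proof -
  have yl: "in_l1 X (y u)" if "0 \<le> u" for u
    using y that by (simp add: l1_solution_def)
  have "\<bar>infsum (y t) X - infsum (y 0) X\<bar> \<le> e" if e: "0 < e" for e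
  proof -
    have int: "((\<lambda>_. 0) has_integral (0::real)) {0..t}"
      by simp
    obtain L where L: "\<And>h r. (h, r) \<in> set L \<Longrightarrow> 0 \<le> r \<and> 0 \<le> h \<and> h \<le> max_step r"
      and err: "l1_norm X (\<lambda>i. y t i - euler X A L (y 0) i) \<le> e"
      using forward_approximation[OF y order_refl t int e] by blast
    define v where "v = euler X A L (y 0)"
    have v: "in_l1 X v" "infsum v X = infsum (y 0) X"
      using euler_l1(1,2)[OF yl[OF order_refl] L] by (simp_all add: v_def)
    have "((\<lambda>i. y t i + - v i) has_sum infsum (y t) X + - infsum v X) X"
      by (intro has_sum_add has_sum_uminusI has_sum_infsum in_l1_summable yl t v)
    then have "infsum (\<lambda>i. y t i - v i) X = infsum (y t) X - infsum v X"
      using infsumI by fastforce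
    then show ?thesis
      using abs_infsum_le_l1_norm[OF in_l1_diff[OF yl[OF t] v(1)]] err v by (simp add: v_def)
  qed
  then have "\<bar>infsum (y t) X - infsum (y 0) X\<bar> \<le> 0"
    by (rule field_le_epsilon) simp
  then show ?thesis by simp
qed

lemma forward_solution_diff:
  assumes "forward_solution lam mu b p" "forward_solution lam mu b p'"
  shows "l1_solution X A (\<lambda>t i. p t i - p' t i)"
    and "0 \<le> t \<Longrightarrow> infsum (\<lambda>i. p t i - p' t i) X = 0"
proof -
  show sol: "l1_solution X A (\<lambda>t i. p t i - p' t i)"
    using assms by (intro l1_solution_diff[OF forward_col_bounded]) (auto simp: forward_solution_def)
  have "((\<lambda>i. p 0 i + - p' 0 i) has_sum 1 + - 1) X"
    using assms by (intro has_sum_add has_sum_uminusI) (auto simp: forward_solution_def prob_vector_def)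
  then have "infsum (\<lambda>i. p 0 i - p' 0 i) X = 0"
    using infsumI by fastforce
  then show "infsum (\<lambda>i. p t i - p' t i) X = 0" if "0 \<le> t"
    using infsum_solution_conserved[OF sol that] by simp
qed

end

context weighted_batch_queue
begin

lemma B_star_star_euler_nonexpansive:
  assumes "0 \<le> r" "0 \<le> h" "h \<le> max_step r"
  shows "col_bounded Y (euler_matrix BB (h, r)) 1"
proof -
  have "1 - h * ((1 - \<delta>) * mu r) \<le> 1"
    using assms \<delta> mu_nonneg by simp
  then show ?thesis
    using B_star_star_euler_contraction[OF assms] by (fastforce simp: col_bounded_def)
qed

lemma B_star_star_approximation:
  assumes "l1_solution Y BB y" "0 \<le> s" "s \<le> t" "(g has_integral G) {s..t}" "0 < e"
  shows "\<exists>L. (\<forall>h r. (h, r) \<in> set L \<longrightarrow> 0 \<le> r \<and> 0 \<le> h \<and> h \<le> max_step r) \<and>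
    \<bar>(\<Sum>(h, r)\<leftarrow>L. h * g r) - G\<bar> < e \<and>
    l1_norm Y (\<lambda>i. y t i - euler Y BB L (y s) i) \<le> e"
  by (rule euler_approximation[OF assms(1-3) _ _ _ assms(4,5),
        where hmax = max_step and C = "\<lambda>r. lam r + 2 * mu r"])
    (rule B_star_star_col_bounded max_step_pos B_star_star_euler_nonexpansive; assumption)+

text \<open>An Euler product misses \<open>w t\<close> by at most e, and its exponent misses G by
  less than e; both errors vanish as e tends to 0 from the right.\<close>

lemma B_star_star_decay:
  assumes sol: "l1_solution Y BB w" and t: "0 \<le> t"
    and int: "((\<lambda>u. (1 - \<delta>) * mu u) has_integral G) {0..t}"
  shows "l1_norm Y (w t) \<le> exp (- G) * l1_norm Y (w 0)"
proof -
  have w: "in_l1 Y (w u)" if "0 \<le> u" for u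
    using sol that by (simp add: l1_solution_def)
  have approx: "l1_norm Y (w t) \<le> e + exp (e - G) * l1_norm Y (w 0)" if e: "0 < e" for e
  proof -
    obtain L where L: "\<And>h r. (h, r) \<in> set L \<Longrightarrow> 0 \<le> r \<and> 0 \<le> h \<and> h \<le> max_step r"
      and sum: "\<bar>(\<Sum>(h, r)\<leftarrow>L. h * ((1 - \<delta>) * mu r)) - G\<bar> < e"
      and err: "l1_norm Y (\<lambda>i. w t i - euler Y BB L (w 0) i) \<le> e"
      using B_star_star_approximation[OF sol order_refl t int e] by blast
    define v where "v = euler Y BB L (w 0)"
    have "in_l1 Y v \<and> l1_norm Y v \<le>
        exp (- (\<Sum>(h, r)\<leftarrow>L. h * ((1 - \<delta>) * mu r))) * l1_norm Y (w 0)"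
      unfolding v_def
      by (rule euler_decay[where P = "\<lambda>h r. 0 \<le> r \<and> 0 \<le> h \<and> h \<le> max_step r"])
        (use w L B_star_star_euler_step in auto)
    then have v: "in_l1 Y v" and v_le: "l1_norm Y v \<le> exp (- (\<Sum>(h, r)\<leftarrow>L. h * ((1 - \<delta>) * mu r))) * l1_norm Y (w 0)"
      by auto
    note v_le
    also have "\<dots> \<le> exp (e - G) * l1_norm Y (w 0)"
      using sum by (intro mult_right_mono) auto
    finally show ?thesis
      using l1_norm_add[OF in_l1_diff[OF w[OF t] v] v] err by (simp add: v_def)
  qed
  have "((\<lambda>e. e + exp (e - G) * l1_norm Y (w 0)) \<longlongrightarrow> 0 + exp (0 - G) * l1_norm Y (w 0)) (at_right 0)"
    by (intro tendsto_intros)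
  moreover have "\<forall>\<^sub>F e in at_right 0. l1_norm Y (w t) \<le> e + exp (e - G) * l1_norm Y (w 0)"
    unfolding eventually_at_right_field using approx by (auto intro: exI[of _ 1])
  ultimately show ?thesis
    using tendsto_lowerbound by fastforce
qed

text \<open>The list is chosen for the solution \<open>y\<close>, yet its decay bound covers every
  tame vector. Weak ergodicity uses this when \<open>y s\<close> itself has no finite weighted
  norm.\<close>

lemma forward_euler:
  assumes y: "l1_solution X A y" and st: "0 \<le> s" "s \<le> t"
    and int: "((\<lambda>u. (1 - \<delta>) * mu u) has_integral G) {s..t}" and e: "0 < e"
  shows "\<exists>L. (\<forall>h r. (h, r) \<in> set L \<longrightarrow> 0 \<le> r \<and> 0 \<le> h \<and> h \<le> max_step r) \<and>
    (\<forall>x. tame x \<longrightarrow> tame (euler X A L x) \<and>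
      l1_norm Y (DT Y \<delta> (euler X A L x)) \<le> exp (e - G) * l1_norm Y (DT Y \<delta> x)) \<and>
    l1_norm X (\<lambda>i. y t i - euler X A L (y s) i) \<le> e"
proof -
  obtain L where L: "\<And>h r. (h, r) \<in> set L \<Longrightarrow> 0 \<le> r \<and> 0 \<le> h \<and> h \<le> max_step r"
    and sum: "\<bar>(\<Sum>(h, r)\<leftarrow>L. h * ((1 - \<delta>) * mu r)) - G\<bar> < e"
    and err: "l1_norm X (\<lambda>i. y t i - euler X A L (y s) i) \<le> e"
    using forward_approximation[OF y st int e] by blast
  have "tame (euler X A L x) \<and>
      l1_norm Y (DT Y \<delta> (euler X A L x)) \<le> exp (e - G) * l1_norm Y (DT Y \<delta> x)" if x: "tame x" for x
  proof -
    have "l1_norm Y (DT Y \<delta> (euler X A L x)) \<le>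
        exp (- (\<Sum>(h, r)\<leftarrow>L. h * ((1 - \<delta>) * mu r))) * l1_norm Y (DT Y \<delta> x)"
      by (rule tame_euler(2)[OF x L])
    also have "\<dots> \<le> exp (e - G) * l1_norm Y (DT Y \<delta> x)"
      using sum by (intro mult_right_mono) auto
    finally show ?thesis
      using tame_euler(1)[OF x L] by simp
  qed
  then show ?thesis
    using L err by blast
qed

text \<open>Each weighted tail is continuous in the plain norm, but with a constant growing with i:
  l1-convergence controls finitely many weighted tails at a time.\<close>

lemma abs_DT_le:
  assumes "in_l1 X x" "i \<in> Y"
  shows "\<bar>DT Y \<delta> x i\<bar> \<le> weight \<delta> i * l1_norm X x"
proof -
  have "\<bar>tail_sum x i\<bar> \<le> l1_norm {j \<in> X. i \<le> j} x"
    unfolding tail_sum_def by (intro abs_infsum_le_l1_norm in_l1_subset[OF assms(1)]) auto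
  also have "\<dots> \<le> l1_norm X x"
    by (intro l1_norm_subset[OF assms(1)]) auto
  finally show ?thesis
    using weight_pos[of i] by (simp add: DT_conv_tail_sum[OF assms(2)] abs_mult)
qed

lemma DT_diff:
  assumes x: "in_l1 X x" and z: "in_l1 X z" and "i \<in> Y"
  shows "DT Y \<delta> (\<lambda>j. x j - z j) i = DT Y \<delta> x i - DT Y \<delta> z i"
proof -
  have "((\<lambda>j. x j + - z j) has_sum tail_sum x i + - tail_sum z i) {j \<in> X. i \<le> j}"
    unfolding tail_sum_def
    by (intro has_sum_add has_sum_uminusI has_sum_infsum in_l1_summable in_l1_subset[OF x] in_l1_subset[OF z]) auto
  then have "tail_sum (\<lambda>j. x j - z j) i = tail_sum x i - tail_sum z i"
    unfolding tail_sum_def using infsumI by fastforce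
  then show ?thesis
    by (simp add: DT_conv_tail_sum[OF \<open>i \<in> Y\<close>] right_diff_distrib)
qed

text \<open>
  The Euler products converge to \<open>y t\<close> only in the unweighted norm. The weighted bound passes
  to the limit on finite index sets (Fatou).
\<close>

lemma forward_DT_decay:
  assumes y: "l1_solution X A y" and st: "0 \<le> s" "s \<le> t"
    and int: "((\<lambda>u. (1 - \<delta>) * mu u) has_integral G) {s..t}" and tame: "tame (y s)"
  shows "in_l1 Y (DT Y \<delta> (y t)) \<and> l1_norm Y (DT Y \<delta> (y t)) \<le> exp (- G) * l1_norm Y (DT Y \<delta> (y s))"
proof (rule l1_bounded_finite_sums)
  fix F assume F: "finite F" "F \<subseteq> Y"
  let ?W = "\<Sum>i\<in>F. weight \<delta> i" and ?N = "l1_norm Y (DT Y \<delta> (y s))"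
  have yt: "in_l1 X (y t)"
    using y st by (simp add: l1_solution_def)
  have approx: "(\<Sum>i\<in>F. \<bar>DT Y \<delta> (y t) i\<bar>) \<le> ?W * e + exp (e - G) * ?N" if e: "0 < e" for e
  proof -
    obtain L where L: "\<And>x. tame x \<Longrightarrow> tame (euler X A L x) \<and>
        l1_norm Y (DT Y \<delta> (euler X A L x)) \<le> exp (e - G) * l1_norm Y (DT Y \<delta> x)"
      and err: "l1_norm X (\<lambda>i. y t i - euler X A L (y s) i) \<le> e"
      using forward_euler[OF y st int e] by blast
    define v where "v = euler X A L (y s)"
    have v: "tame v" "l1_norm Y (DT Y \<delta> v) \<le> exp (e - G) * ?N"
      using L[OF tame] by (simp_all add: v_def)
    then have vl: "in_l1 X v" "in_l1 Y (DT Y \<delta> v)"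
      by (simp_all add: tame_def)
    have "\<bar>DT Y \<delta> (y t) i\<bar> \<le> weight \<delta> i * e + \<bar>DT Y \<delta> v i\<bar>" if "i \<in> F" for i
    proof -
      have i: "i \<in> Y" using that F by auto
      have "\<bar>DT Y \<delta> (\<lambda>j. y t j - v j) i\<bar> \<le> weight \<delta> i * l1_norm X (\<lambda>j. y t j - v j)"
        by (rule abs_DT_le[OF in_l1_diff[OF yt vl(1)] i])
      also have "\<dots> \<le> weight \<delta> i * e"
        using err weight_pos[of i] by (intro mult_left_mono) (auto simp: v_def)
      finally show ?thesis
        unfolding DT_diff[OF yt vl(1) i] by linarith
    qed
    then have "(\<Sum>i\<in>F. \<bar>DT Y \<delta> (y t) i\<bar>) \<le> (\<Sum>i\<in>F. weight \<delta> i * e + \<bar>DT Y \<delta> v i\<bar>)"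
      by (rule sum_mono)
    also have "\<dots> = ?W * e + (\<Sum>i\<in>F. \<bar>DT Y \<delta> v i\<bar>)"
      by (simp add: sum.distrib sum_distrib_right)
    finally show ?thesis
      using finite_sum_le_l1_norm[OF vl(2) F] v(2) by linarith
  qed
  have "((\<lambda>e. ?W * e + exp (e - G) * ?N) \<longlongrightarrow> ?W * 0 + exp (0 - G) * ?N) (at_right 0)"
    by (intro tendsto_intros)
  moreover have "\<forall>\<^sub>F e in at_right 0. (\<Sum>i\<in>F. \<bar>DT Y \<delta> (y t) i\<bar>) \<le> ?W * e + exp (e - G) * ?N"
    unfolding eventually_at_right_field using approx by (auto intro: exI[of _ 1])
  ultimately show "(\<Sum>i\<in>F. \<bar>DT Y \<delta> (y t) i\<bar>) \<le> exp (- G) * ?N"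
    using tendsto_lowerbound by fastforce
qed

end

section \<open>Weak ergodicity by approximation with tame vectors\<close>

context batch_queue
begin

lemma euler_nonexpansive:
  assumes "in_l1 X x" "in_l1 X z" and "\<And>h r. (h, r) \<in> set L \<Longrightarrow> 0 \<le> r \<and> 0 \<le> h \<and> h \<le> max_step r"
  shows "l1_norm X (\<lambda>i. euler X A L x i - euler X A L z i) \<le> l1_norm X (\<lambda>i. x i - z i)"
  using assms
proof (induction L arbitrary: x z)
  case (Cons p L)
  obtain h r where p: "p = (h, r)" by (cases p)
  have r: "0 \<le> r" and h: "0 \<le> h" "h \<le> max_step r"
    using Cons.prems(3)[of h r] p by auto
  note l1 = euler_step_l1[of X A r, OF forward_col_bounded[OF r]]
  have "l1_norm X (\<lambda>i. euler X A (p # L) x i - euler X A (p # L) z i) \<le>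
      l1_norm X (\<lambda>i. euler_step X A p x i - euler_step X A p z i)"
    unfolding p euler_simps by (rule Cons.IH) (use l1 Cons.prems in auto)
  also have "\<dots> \<le> l1_norm X (\<lambda>i. x i - z i)"
    unfolding p by (rule euler_step_nonexpansive[of X A r, OF forward_col_bounded[OF r]
        forward_euler_contraction[OF r h] Cons.prems(1,2)])
  finally show ?case .
qed simp

end

context weighted_batch_queue
begin

text \<open>Cut y off outside a finite set and put the lost mass at state 0 to restore zero sum. The
  omitted part and the correction at 0 each cost at most R. Finite support makes all distant tails
  vanish, so the weighted norm is finite.\<close>

lemma tame_dense:
  assumes y: "in_l1 X y" and zero: "infsum y X = 0" and e: "0 < e"
  obtains x where "tame x" "l1_norm X (\<lambda>i. y i - x i) \<le> e"
proof -
  have "(\<lambda>i. \<bar>y i\<bar>) summable_on X"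
    using y by (simp add: in_l1_def)
  then obtain F where F: "finite F" "F \<subseteq> X" "dist (\<Sum>i\<in>F. \<bar>y i\<bar>) (l1_norm X y) \<le> e / 2"
    using infsum_finite_approximation[of "\<lambda>i. \<bar>y i\<bar>" X "e / 2"] e unfolding l1_norm_def by auto
  define G where "G = insert 0 F"
  have G: "finite G" "G \<subseteq> X" "0 \<in> G"
    using F zero_in_states by (auto simp: G_def)
  define R where "R = l1_norm (X - G) y"
  define x where "x = (\<lambda>i. if i = 0 then - (\<Sum>i\<in>G - {0}. y i) else if i \<in> G then y i else 0)"
  have sub: "in_l1 S y" if "S \<subseteq> X" for S
    by (rule in_l1_subset[OF y that])
  have GX: "G \<union> (X - G) = X" using G by auto
  have "l1_norm X y = (\<Sum>i\<in>G. \<bar>y i\<bar>) + R"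
    using infsum_Un_disjoint[of "\<lambda>i. \<bar>y i\<bar>" G "X - G"] sub[of "X - G"] G
    unfolding GX by (simp add: l1_norm_def R_def in_l1_def)
  moreover have "(\<Sum>i\<in>F. \<bar>y i\<bar>) \<le> (\<Sum>i\<in>G. \<bar>y i\<bar>)"
    using G by (intro sum_mono2) (auto simp: G_def)
  ultimately have R: "R \<le> e / 2"
    using F(3) unfolding dist_real_def by linarith
  have "infsum y X = (\<Sum>i\<in>G. y i) + infsum y (X - G)"
    using infsum_Un_disjoint[of y G "X - G"] in_l1_summable[OF sub[of "X - G"]] G
    unfolding GX by simp
  then have "\<bar>\<Sum>i\<in>G. y i\<bar> \<le> R"
    using abs_infsum_le_l1_norm[OF sub[of "X - G"]] zero by (auto simp: R_def)
  \<comment> \<open>The correction y 0 - x 0 is the sum of y over G, which by zero total sum is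
    minus the sum outside G.\<close>
  then have x0: "\<bar>y 0 - x 0\<bar> \<le> R"
    using sum.remove[OF G(1,3), of y] by (simp add: x_def)
  show ?thesis
  proof (rule that)
    have x_zero: "x j = 0" if "j \<notin> G" for j
      using that G by (auto simp: x_def)
    have "in_l1 X x"
      by (rule in_l1_finite_support[OF G(1)]) (auto simp: x_zero)
    moreover have "(x has_sum 0) X"
      by (rule has_sum_finite_neutralI[OF G(1,2)])
        (auto simp: x_zero sum.remove[OF G(1,3)] intro!: sum.cong, auto simp: x_def)
    moreover have "in_l1 Y (DT Y \<delta> x)"
    proof (rule in_l1_finite_support)
      fix i assume i: "i \<in> Y - {..Max G}"
      then have "tail_sum x i = 0"
        unfolding tail_sum_def using Max_ge[OF G(1)] by (intro infsum_0 x_zero) fastforce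
      then show "DT Y \<delta> x i = 0"
        using i by (simp add: DT_conv_tail_sum)
    qed simp
    ultimately show "tame x"
      by (simp add: tame_def infsumI)
    have "in_l1 X (\<lambda>i. y i - x i) \<and> l1_norm X (\<lambda>i. y i - x i) \<le> R + R"
    proof (rule l1_norm_le_has_sum)
      have "((\<lambda>i. if i = 0 then R else 0) has_sum R) X"
        by (rule has_sum_finite_neutralI[of "{0}"]) (use zero_in_states in auto)
      moreover have "((\<lambda>i. if i \<in> G then 0 else \<bar>y i\<bar>) has_sum R) X"
        using has_sum_infsum[of "\<lambda>i. \<bar>y i\<bar>" "X - G"] sub[of "X - G"] unfolding R_def l1_norm_def
        by (subst has_sum_cong_neutral[of "X - G" _ "\<lambda>i. \<bar>y i\<bar>"]) (auto simp: in_l1_def)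
      ultimately show "((\<lambda>i. (if i = 0 then R else 0) + (if i \<in> G then 0 else \<bar>y i\<bar>)) has_sum R + R) X"
        by (rule has_sum_add)
      show "\<bar>y i - x i\<bar> \<le> (if i = 0 then R else 0) + (if i \<in> G then 0 else \<bar>y i\<bar>)" for i
        using x0 G by (auto simp: x_def)
    qed
    then show "l1_norm X (\<lambda>i. y i - x i) \<le> e"
      using R by simp
  qed
qed

text \<open>The tame x near \<open>y 0\<close> is fixed before t, so its weighted norm K is a
  constant while G t grows. The list of steps depends on t, but being nonexpansive it never enlarges
  the distance between the images of \<open>y 0\<close> and x.\<close>

lemma weakly_ergodic_if_integral_diverges:
  assumes int: "\<And>t. 0 \<le> t \<Longrightarrow> ((\<lambda>u. (1 - \<delta>) * mu u) has_integral G t) {0..t}"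
    and G: "filterlim G at_top at_top"
  shows "weakly_ergodic lam mu b"
  unfolding weakly_ergodic_def
proof (intro allI impI)
  fix p p' assume p: "forward_solution lam mu b p" "forward_solution lam mu b p'"
  define y where "y = (\<lambda>t i. p t i - p' t i)"
  have sol: "l1_solution X A y" and zero: "infsum (y 0) X = 0"
    using forward_solution_diff(1)[OF p] forward_solution_diff(2)[OF p order_refl] by (simp_all add: y_def)
  have yl: "in_l1 X (y t)" if "0 \<le> t" for t
    using sol that by (simp add: l1_solution_def)
  have "((\<lambda>t. l1_norm X (y t)) \<longlongrightarrow> 0) at_top"
  proof (rule tendstoI)
    fix e :: real assume "0 < e"
    \<comment> \<open>Three contributions of size d have to stay below e: the Euler error, the
      distance from \<open>y 0\<close> to x, and the decayed image of x.\<close>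
    define d where "d = e / 4"
    have d: "0 < d" using \<open>0 < e\<close> by (simp add: d_def)
    obtain x where x: "tame x" and yx: "l1_norm X (\<lambda>i. y 0 i - x i) \<le> d"
      by (rule tame_dense[OF yl[OF order_refl] zero d])
    define K where "K = l1_norm Y (DT Y \<delta> x)"
    have xl: "in_l1 X x" using x by (simp add: tame_def)
    have le: "l1_norm X (y t) \<le> d + (d + 2 * (exp (d - G t) * K))" if t: "0 \<le> t" for t
    proof -
      obtain L where L: "\<And>h r. (h, r) \<in> set L \<Longrightarrow> 0 \<le> r \<and> 0 \<le> h \<and> h \<le> max_step r"
        and Lx: "\<And>x. tame x \<Longrightarrow> tame (euler X A L x) \<and>
          l1_norm Y (DT Y \<delta> (euler X A L x)) \<le> exp (d - G t) * l1_norm Y (DT Y \<delta> x)"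
        and err: "l1_norm X (\<lambda>i. y t i - euler X A L (y 0) i) \<le> d"
        using forward_euler[OF sol order_refl t int[OF t] d] by blast
      have El: "in_l1 X (euler X A L (y 0))" "in_l1 X (euler X A L x)"
        using euler_l1(1)[OF yl[OF order_refl] L] euler_l1(1)[OF xl L] by auto
      have "l1_norm X (y t) \<le> l1_norm X (\<lambda>i. y t i - euler X A L (y 0) i) + l1_norm X (euler X A L (y 0))"
        using l1_norm_add[OF in_l1_diff[OF yl[OF t] El(1)] El(1)] by simp
      moreover have "l1_norm X (euler X A L (y 0)) \<le>
          l1_norm X (\<lambda>i. euler X A L (y 0) i - euler X A L x i) + l1_norm X (euler X A L x)"
        using l1_norm_add[OF in_l1_diff[OF El] El(2)] by simp
      moreover have "l1_norm X (\<lambda>i. euler X A L (y 0) i - euler X A L x i) \<le> l1_norm X (\<lambda>i. y 0 i - x i)"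
        by (rule euler_nonexpansive[OF yl[OF order_refl] xl L])
      moreover have "l1_norm X (euler X A L x) \<le> 2 * (exp (d - G t) * K)"
        using l1_norm_le_DT[of "euler X A L x"] Lx[OF x] unfolding K_def by linarith
      ultimately show ?thesis
        using err yx by linarith
    qed
    have "filterlim (\<lambda>t. d - G t) at_bot at_top"
      using filterlim_tendsto_add_at_top[OF tendsto_const G, of "- d"]
      unfolding filterlim_uminus_at_top by simp
    then have "((\<lambda>t. exp (d - G t)) \<longlongrightarrow> 0) at_top"
      by (rule filterlim_compose[OF exp_at_bot])
    then have "((\<lambda>t. 2 * (exp (d - G t) * K)) \<longlongrightarrow> 2 * (0 * K)) at_top"
      by (intro tendsto_intros)
    then have "\<forall>\<^sub>F t in at_top. 2 * (exp (d - G t) * K) < d"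
      using d by (intro order_tendstoD) auto
    then show "\<forall>\<^sub>F t in at_top. dist (l1_norm X (y t)) 0 < e"
      using eventually_ge_at_top[of 0]
    proof eventually_elim
      case (elim t)
      then show ?case
        using le[of t] d by (simp add: d_def)
    qed
  qed
  then show "((\<lambda>t. l1_norm X (\<lambda>i. p t i - p' t i)) \<longlongrightarrow> 0) at_top"
    by (simp add: y_def)
qed

end

section \<open>Divergence of the integral and assembly of the result\<close>

lemma integral_at_top_if_nn_integral_infinite:
  fixes f :: "real \<Rightarrow> real"
  assumes nonneg: "\<And>t. 0 \<le> t \<Longrightarrow> 0 \<le> f t"
    and int: "\<And>t. 0 \<le> t \<Longrightarrow> f absolutely_integrable_on {0..t}"
    and inf: "(\<integral>\<^sup>+t\<in>{0..}. ennreal (f t) \<partial>lebesgue) = \<infinity>"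
  shows "filterlim (\<lambda>t. integral {0..t} f) at_top at_top"
  unfolding filterlim_at_top
proof
  fix Z :: real
  have "\<exists>n::nat. Z < integral {0..real n} f"
  proof (rule ccontr)
    assume "\<not> (\<exists>n::nat. Z < integral {0..real n} f)"
    then have le: "integral {0..real n} f \<le> Z" for n
      by (meson not_le)
    \<comment> \<open>Truncations at integers increase to the integrand, so monotone convergence
      would bound the full integral by Z if all truncated integrals were at most Z.\<close>
    define g where "g = (\<lambda>(n::nat) t. ennreal (f t) * indicator {0..real n} t)"
    have g_eq: "g n t = ennreal (indicator {0..real n} t *\<^sub>R f t)" for n t
      using nonneg by (auto simp: g_def indicator_def)
    have set_int: "integrable lebesgue (\<lambda>t. indicator {0..real n} t *\<^sub>R f t)" for n
      using int[of "real n"] by (simp add: set_integrable_def)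
    have "(\<integral>\<^sup>+t. g n t \<partial>lebesgue) = ennreal (integral {0..real n} f)" for n
      unfolding g_eq
      using nn_integral_eq_integral[OF set_int[of n]] nonneg
        set_lebesgue_integral_eq_integral(2)[OF int[of "real n"]]
      by (auto simp: set_lebesgue_integral_def indicator_def)
    then have g_le: "(\<integral>\<^sup>+t. g n t \<partial>lebesgue) \<le> ennreal Z" for n
      using le by (simp add: ennreal_leI)
    have "(SUP n. g n t) = ennreal (f t) * indicator {0..} t" for t
    proof (rule antisym)
      show "(SUP n. g n t) \<le> ennreal (f t) * indicator {0..} t"
        by (intro SUP_least) (auto simp: g_def indicator_def)
      obtain n :: nat where "t \<le> real n"
        using real_arch_simple by blast
      then have "ennreal (f t) * indicator {0..} t \<le> g n t"
        by (auto simp: g_def indicator_def)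
      also have "\<dots> \<le> (SUP n. g n t)"
        by (rule SUP_upper) simp
      finally show "ennreal (f t) * indicator {0..} t \<le> (SUP n. g n t)" .
    qed
    then have "(\<integral>\<^sup>+t\<in>{0..}. ennreal (f t) \<partial>lebesgue) = (\<integral>\<^sup>+t. (SUP n. g n t) \<partial>lebesgue)"
      by simp
    also have "\<dots> = (SUP n. \<integral>\<^sup>+t. g n t \<partial>lebesgue)"
    proof (rule nn_integral_monotone_convergence_SUP)
      show "incseq g"
        by (auto simp: incseq_def le_fun_def g_def indicator_def)
      show "g n \<in> borel_measurable lebesgue" for n
        using borel_measurable_integrable[OF set_int[of n]] unfolding g_eq by simp
    qed
    also have "\<dots> \<le> ennreal Z"
      by (intro SUP_least g_le)
    finally show False
      using inf by (simp add: top_unique)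
  qed
  then obtain n :: nat where n: "Z < integral {0..real n} f" ..
  have "Z \<le> integral {0..t} f" if "real n \<le> t" for t
  proof -
    have "integral {0..real n} f \<le> integral {0..t} f"
      using that nonneg int[of t] int[of "real n"]
      by (intro integral_subset_le) (auto intro: set_lebesgue_integral_eq_integral(1))
    then show ?thesis using n by simp
  qed
  then show "\<forall>\<^sub>F t in at_top. Z \<le> integral {0..t} f"
    unfolding eventually_at_top_linorder by blast
qed

theorem mainTheorem1:
  fixes lam mu :: "real \<Rightarrow> real" and b :: "nat pmf" and L q C :: real
  assumes "\<And>t. 0 \<le> t \<Longrightarrow> 0 \<le> lam t"
    and "\<And>t. 0 \<le> t \<Longrightarrow> 0 \<le> mu t"
    and "\<And>t. 0 \<le> t \<Longrightarrow> lam absolutely_integrable_on {0..t}"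
    and "\<And>t. 0 \<le> t \<Longrightarrow> mu absolutely_integrable_on {0..t}"
    and "\<And>t. 0 \<le> t \<Longrightarrow> lam t \<le> L"
    and "0 \<notin> set_pmf b"
    and "integrable (measure_pmf b) real"
    and "0 < q" and "q < 1" and "0 < C"
    and "\<And>k. 1 \<le> k \<Longrightarrow> pmf b k \<le> C * q ^ k"
    and "(\<integral>\<^sup>+t\<in>{0..}. ennreal (mu t) \<partial>lebesgue) = \<infinity>"
  shows "weakly_ergodic lam mu b \<and>
    (\<forall>\<delta>\<in>{q<..<1}. \<forall>w. l1_solution (pos_states b) (B_star_star lam mu b \<delta>) w \<longrightarrow>
       (\<forall>t\<ge>0. l1_norm (pos_states b) (w t) \<le>
          exp (- integral {0..t} (\<lambda>u. (1 - \<delta>) * mu u)) * l1_norm (pos_states b) (w 0))) \<and>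
    (\<forall>\<delta>\<in>{q<..<1}.
       (\<exists>N>0. \<exists>a>0. \<forall>s t. 0 \<le> s \<longrightarrow> s \<le> t \<longrightarrow>
          exp (- integral {s..t} (\<lambda>u. (1 - \<delta>) * mu u)) \<le> N * exp (- a * (t - s))) \<longrightarrow>
       exp_weakly_ergodic lam mu b \<delta>)"
proof -
  have queue: "weighted_batch_queue lam mu b \<delta>" if "0 < \<delta>" "\<delta> < 1" for \<delta>
    using assms(1,2,6) that by unfold_locales auto
  have int: "((\<lambda>u. (1 - \<delta>) * mu u) has_integral integral {s..t} (\<lambda>u. (1 - \<delta>) * mu u)) {s..t}"
    if "0 \<le> s" "s \<le> t" for s t \<delta>
  proof -
    have "mu integrable_on {0..t}"
      using assms(4)[of t] that by (auto intro: set_lebesgue_integral_eq_integral(1))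
    then have "mu integrable_on {s..t}"
      by (rule integrable_on_subinterval) (use that in auto)
    then have "(\<lambda>u. (1 - \<delta>) * mu u) integrable_on {s..t}"
      by (rule integrable_on_mult_right)
    then show ?thesis
      by (rule integrable_integral)
  qed
  have "weakly_ergodic lam mu b"
  proof -
    \<comment> \<open>Weak ergodicity does not mention \<delta>, so any weight in (0, 1) can serve
      as an auxiliary tool.\<close>
    interpret weighted_batch_queue lam mu b "1 / 2"
      by (rule queue) auto
    show ?thesis
    proof (rule weakly_ergodic_if_integral_diverges[OF int[OF order_refl]])
      have "filterlim (\<lambda>t. integral {0..t} mu) at_top at_top"
        by (rule integral_at_top_if_nn_integral_infinite[OF assms(2,4,12)])
      then have "filterlim (\<lambda>t. (1 - 1 / 2) * integral {0..t} mu) at_top at_top"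
        by (rule filterlim_tendsto_pos_mult_at_top[OF tendsto_const, rotated]) simp
      then show "filterlim (\<lambda>t. integral {0..t} (\<lambda>u. (1 - 1 / 2) * mu u)) at_top at_top"
        by (simp only: integral_mult_right)
    qed
  qed
  moreover have "l1_norm (pos_states b) (w t) \<le>
      exp (- integral {0..t} (\<lambda>u. (1 - \<delta>) * mu u)) * l1_norm (pos_states b) (w 0)"
    if "\<delta> \<in> {q<..<1}" "l1_solution (pos_states b) (B_star_star lam mu b \<delta>) w" "0 \<le> t" for \<delta> w t
  proof -
    interpret weighted_batch_queue lam mu b \<delta>
      using assms(8) that by (intro queue) auto
    show ?thesis
      by (rule B_star_star_decay[OF that(2,3) int[OF order_refl that(3)]])
  qed
  moreover have "exp_weakly_ergodic lam mu b \<delta>"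
    if \<delta>: "\<delta> \<in> {q<..<1}" and N: "0 < N" "0 < a"
      and le: "\<And>s t. 0 \<le> s \<Longrightarrow> s \<le> t \<Longrightarrow>
        exp (- integral {s..t} (\<lambda>u. (1 - \<delta>) * mu u)) \<le> N * exp (- a * (t - s))" for \<delta> N a
  proof -
    interpret weighted_batch_queue lam mu b \<delta>
      using assms(8) \<delta> by (intro queue) auto
    show ?thesis
      unfolding exp_weakly_ergodic_def Let_def
    \<comment> \<open>The constants of the integral bound serve directly, because the weighted norm
      decays with factor 1 times the exponential.\<close>
    proof (rule exI[of _ N], rule conjI[OF N(1)], rule exI[of _ a], rule conjI[OF N(2)],
        intro allI impI conjI)
      fix p p' s t
      assume p: "forward_solution lam mu b p" "forward_solution lam mu b p'"
        and st: "0 \<le> s" "s \<le> t" and fin: "in_l1 Y (DT Y \<delta> (\<lambda>i. p s i - p' s i))"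
      note sol = forward_solution_diff(1)[OF p]
      have "tame (\<lambda>i. p s i - p' s i)"
        using sol st fin forward_solution_diff(2)[OF p st(1)] by (simp add: tame_def l1_solution_def)
      note decay = forward_DT_decay[OF sol st int[OF st] this]
      show "in_l1 Y (DT Y \<delta> (\<lambda>i. p t i - p' t i))"
        using decay by simp
      have "exp (- integral {s..t} (\<lambda>u. (1 - \<delta>) * mu u)) * l1_norm Y (DT Y \<delta> (\<lambda>i. p s i - p' s i)) \<le>
          N * exp (- a * (t - s)) * l1_norm Y (DT Y \<delta> (\<lambda>i. p s i - p' s i))"
        by (intro mult_right_mono le st) simp
      then show "l1_norm Y (DT Y \<delta> (\<lambda>i. p t i - p' t i)) \<le>
          N * exp (- a * (t - s)) * l1_norm Y (DT Y \<delta> (\<lambda>i. p s i - p' s i))"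
        using decay by linarith
    qed
  qed
  ultimately show ?thesis
    by blast
qed

end
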